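(* Let $\mathscr{E}=\{\eta_i,\rho_i\}_{i=1}^n$ be a multipartite quantum state ensemble on $\mathscr{H}=\bigotimes_{k=1}^m\mathbb{C}^{d_k}$, and let $\rho_0=\sum_{i=1}^n\eta_i\rho_i$. Then for each $j=1,\ldots,n$, $$\mathcal{L}_j(\mathscr{E})=\mathcal{S}_j(\mathscr{E})=\max_{\substack{M\in\mathbb{SEP}\\ \operatorname{Tr}(\rho_0 M)=1}}\eta_j\operatorname{Tr}(\rho_j M),$$ where the maximum is taken over all separable operators $M$ with $\operatorname{Tr}(\rho_0 M)=1$.
   Context: Let $\mathscr{H}=\bigotimes_{k=1}^m\mathbb{C}^{d_k}$ with $m\geqslant 2$ and positive integers $d_1,\ldots,d_m$. $\mathbb{H}$ is the set of Hermitian operators on $\mathscr{H}$, and $\mathbb{H}_+\subseteq\mathbb{H}$ is the set of positive-semidefinite ones. A state is $\rho\in\mathbb{H}_+$ with $\operatorname{Tr}\rho=1$. An ensemble $\{\eta_i,\rho_i\}_{i=1}^n$ consists of states $\rho_i$ with nonzero probabilities $\eta_i$ (so $\eta_i>0$, $\sum_i\eta_i=1$). An operator $E\in\mathbb{H}_+$ is separable if $E=\sum_l p_l\bigotimes_{k=1}^m\sigma_l^{(k)}$ with $p_l\geqslant 0$ and $\sigma_l^{(k)}$ states on $\mathbb{C}^{d_k}$; $\mathbb{SEP}$ is the set of all separable operators. A measurement is a family $\mathscr{M}=\{M_i\}_{i=0}^n\subseteq\mathbb{H}_+$ with $\sum_i M_i=\mathbb{1}$ (the outcome $M_0$ is inconclusive;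 outcome $M_i$, $i\geqslant 1$, means guessing $\rho_i$). It is a separable measurement if all $M_i\in\mathbb{SEP}$. It is an LOCC measurement if it can be realized by local operations and classical communication, i.e. by a protocol in which the $m$ parties perform local quantum operations and measurements on their own subsystems (possibly using randomness and depending on previously communicated messages), exchange classical messages, and determine the final outcome from the classical record. Every LOCC measurement is a separable measurement. For a measurement with $\operatorname{Tr}(\rho_0M_j)\neq0$, the confidence to identify $\rho_j$ is $\Pr(\rho_j|M_j)=\dfrac{\eta_j\operatorname{Tr}(\rho_jM_j)}{\operatorname{Tr}(\rho_0M_j)}$. $\mathcal{S}_j(\mathscr{E})$ denotes the maximum of $\Pr(\rho_j|M_j)$ over all separable measurements $\mathscr{M}=\{M_i\}_{i=0}^n$ with $\operatorname{Tr}(\rho_0M_j)\neq 0$, and $\mathcal{L}_j(\mathscr{E})$ denotes the maximum of $\Pr(\rho_j|M_j)$ over all LOCC measurements $\mathscr{M}=\{M_i\}_{i=0}^n$ with $\operatorname{Tr}(\rho_0M_j)\neq 0$.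
   Formalization: The maxima need not be attained when ρ₀ is singular; proved instead: the three suprema are equal, a number is the maximum of one value set iff of the others, and the maximum exists when ρ₀ is invertible. *)

theory Defs
  imports Complex_Main "Jordan_Normal_Form.Schur_Decomposition"
begin

definition mtrace :: "complex mat \<Rightarrow> complex" where
  "mtrace A = (\<Sum>i<dim_row A. A $$ (i, i))"

definition sum_mats :: "nat \<Rightarrow> complex mat list \<Rightarrow> complex mat" where
  "sum_mats d As = foldr (+) As (0\<^sub>m d d)"

text \<open>The order on \<^typ>\<open>complex\<close> is the one with \<open>0 \<le> z\<close> iff \<open>z\<close> is real and nonnegative.\<close>

definition psd :: "nat \<Rightarrow> complex mat \<Rightarrow> bool" where
  "psd d A \<longleftrightarrow> A \<in> carrier_mat d d \<and> mat_adjoint A = A \<and>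
     (\<forall>v \<in> carrier_vec d. 0 \<le> (A *\<^sub>v v) \<bullet>c v)"

definition state :: "nat \<Rightarrow> complex mat \<Rightarrow> bool" where
  "state d \<rho> \<longleftrightarrow> psd d \<rho> \<and> mtrace \<rho> = 1"

text \<open>
  A list \<open>ds = [d\<^sub>1, \<dots>, d\<^sub>m]\<close> of local dimensions stands for the tensor product of the spaces
  of dimension \<open>d\<^sub>k\<close>, identified with the coordinate space of dimension \<open>prod_list ds\<close>
  through the lexicographic order of the product basis, so that tensor products of operators
  become Kronecker products. Parties are numbered from 0.
\<close>

definition kron :: "complex mat \<Rightarrow> complex mat \<Rightarrow> complex mat" where
  "kron A B = mat (dim_row A * dim_row B) (dim_col A * dim_col B)
     (\<lambda>(i, j). A $$ (i div dim_row B, j div dim_col B) * B $$ (i mod dim_row B, j mod dim_col B))"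

definition tensor :: "complex mat list \<Rightarrow> complex mat" where
  "tensor As = foldr kron As (1\<^sub>m 1)"

definition SEP :: "nat list \<Rightarrow> complex mat set" where
  "SEP ds = {E. psd (prod_list ds) E \<and>
     (\<exists>ts :: (real \<times> complex mat list) list.
        (\<forall>(p, \<sigma>s) \<in> set ts. 0 \<le> p \<and> list_all2 state ds \<sigma>s) \<and>
        E = sum_mats (prod_list ds) (map (\<lambda>(p, \<sigma>s). complex_of_real p \<cdot>\<^sub>m tensor \<sigma>s) ts))}"

definition ensemble :: "nat list \<Rightarrow> nat \<Rightarrow> (nat \<Rightarrow> real) \<Rightarrow> (nat \<Rightarrow> complex mat) \<Rightarrow> bool" where
  "ensemble ds n \<eta> \<rho> \<longleftrightarrow>
     (\<forall>i \<in> {1..n}. 0 < \<eta> i \<and> state (prod_list ds) (\<rho> i)) \<and> (\<Sum>i = 1..n. \<eta> i) = 1"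

definition avg_state :: "nat list \<Rightarrow> nat \<Rightarrow> (nat \<Rightarrow> real) \<Rightarrow> (nat \<Rightarrow> complex mat) \<Rightarrow> complex mat" where
  "avg_state ds n \<eta> \<rho> =
     sum_mats (prod_list ds) (map (\<lambda>i. complex_of_real (\<eta> i) \<cdot>\<^sub>m \<rho> i) [1..<Suc n])"

definition measurement :: "nat list \<Rightarrow> nat \<Rightarrow> (nat \<Rightarrow> complex mat) \<Rightarrow> bool" where
  "measurement ds n M \<longleftrightarrow> (\<forall>i \<le> n. psd (prod_list ds) (M i)) \<and>
     sum_mats (prod_list ds) (map M [0..<Suc n]) = 1\<^sub>m (prod_list ds)"

definition separable_measurement :: "nat list \<Rightarrow> nat \<Rightarrow> (nat \<Rightarrow> complex mat) \<Rightarrow> bool" where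
  "separable_measurement ds n M \<longleftrightarrow> measurement ds n M \<and> (\<forall>i \<le> n. M i \<in> SEP ds)"

text \<open>
  An LOCC protocol is a finite tree. \<open>Local k bs\<close> means that party \<open>k\<close> applies a quantum
  instrument with one classical result for each entry \<open>(d', Ks, P)\<close> of \<open>bs\<close> and announces the
  result: \<open>Ks\<close> are the Kraus operators of the completely positive map belonging to that result,
  \<open>d'\<close> is the dimension of the party's system afterwards (so ancillas can be attached and
  subsystems discarded), and \<open>P\<close> is how the protocol goes on. \<open>Output i\<close> ends the protocol with
  outcome \<open>i\<close>; as a leaf is determined by the path to it, the outcome is a function of the
  classical record. Local and shared randomness are instruments with Kraus operators proportional
  to the identity.
\<close>

datatype protocol = Output nat | Local nat "(nat \<times> complex mat list \<times> protocol) list"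

fun valid_protocol :: "nat \<Rightarrow> nat list \<Rightarrow> protocol \<Rightarrow> bool" where
  "valid_protocol n ds (Output i) \<longleftrightarrow> i \<le> n"
| "valid_protocol n ds (Local k bs) \<longleftrightarrow> k < length ds \<and>
     (\<forall>(d', Ks, P) \<in> set bs. 0 < d' \<and> set Ks \<subseteq> carrier_mat d' (ds ! k) \<and>
        valid_protocol n (ds[k := d']) P) \<and>
     sum_mats (ds ! k)
       (map (\<lambda>K. mat_adjoint K * K) (concat (map (\<lambda>(d', Ks, P). Ks) bs))) = 1\<^sub>m (ds ! k)"

definition extend_op :: "nat list \<Rightarrow> nat \<Rightarrow> complex mat \<Rightarrow> complex mat" where
  "extend_op ds k K = tensor ((map (\<lambda>d. 1\<^sub>m d) ds)[k := K])"

definition apply_kraus :: "nat list \<Rightarrow> nat \<Rightarrow> nat \<Rightarrow> complex mat list \<Rightarrow> complex mat \<Rightarrow> complex mat" where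
  "apply_kraus ds k d' Ks \<rho> = sum_mats (prod_list (ds[k := d']))
     (map (\<lambda>K. extend_op ds k K * \<rho> * mat_adjoint (extend_op ds k K)) Ks)"

text \<open>
  \<open>outcome_prob ds P \<rho> i\<close> is the probability that \<open>P\<close>, run on \<open>\<rho>\<close>, ends with outcome \<open>i\<close>. The
  states passed down the tree are not normalised: their trace is the probability of the
  record so far.
\<close>

fun outcome_prob :: "nat list \<Rightarrow> protocol \<Rightarrow> complex mat \<Rightarrow> nat \<Rightarrow> complex" where
  "outcome_prob ds (Output i') \<rho> i = (if i = i' then mtrace \<rho> else 0)"
| "outcome_prob ds (Local k bs) \<rho> i =
     (\<Sum>(d', Ks, P) \<leftarrow> bs. outcome_prob (ds[k := d']) P (apply_kraus ds k d' Ks \<rho>) i)"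

definition LOCC_measurement :: "nat list \<Rightarrow> nat \<Rightarrow> (nat \<Rightarrow> complex mat) \<Rightarrow> bool" where
  "LOCC_measurement ds n M \<longleftrightarrow> measurement ds n M \<and>
     (\<exists>P. valid_protocol n ds P \<and>
        (\<forall>\<rho>. state (prod_list ds) \<rho> \<longrightarrow> (\<forall>i \<le> n. outcome_prob ds P \<rho> i = mtrace (\<rho> * M i))))"

text \<open>All traces below are traces of products of two positive semidefinite operators, hence real.\<close>

definition confidence ::
  "nat list \<Rightarrow> nat \<Rightarrow> (nat \<Rightarrow> real) \<Rightarrow> (nat \<Rightarrow> complex mat) \<Rightarrow> nat \<Rightarrow> (nat \<Rightarrow> complex mat) \<Rightarrow> real" where
  "confidence ds n \<eta> \<rho> j M =
     \<eta> j * Re (mtrace (\<rho> j * M j)) / Re (mtrace (avg_state ds n \<eta> \<rho> * M j))"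

definition sep_values :: "nat list \<Rightarrow> nat \<Rightarrow> (nat \<Rightarrow> real) \<Rightarrow> (nat \<Rightarrow> complex mat) \<Rightarrow> nat \<Rightarrow> real set" where
  "sep_values ds n \<eta> \<rho> j = {confidence ds n \<eta> \<rho> j M | M.
     separable_measurement ds n M \<and> mtrace (avg_state ds n \<eta> \<rho> * M j) \<noteq> 0}"

definition locc_values :: "nat list \<Rightarrow> nat \<Rightarrow> (nat \<Rightarrow> real) \<Rightarrow> (nat \<Rightarrow> complex mat) \<Rightarrow> nat \<Rightarrow> real set" where
  "locc_values ds n \<eta> \<rho> j = {confidence ds n \<eta> \<rho> j M | M.
     LOCC_measurement ds n M \<and> mtrace (avg_state ds n \<eta> \<rho> * M j) \<noteq> 0}"

definition sep_operator_values ::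
  "nat list \<Rightarrow> nat \<Rightarrow> (nat \<Rightarrow> real) \<Rightarrow> (nat \<Rightarrow> complex mat) \<Rightarrow> nat \<Rightarrow> real set" where
  "sep_operator_values ds n \<eta> \<rho> j = {\<eta> j * Re (mtrace (\<rho> j * M)) | M.
     M \<in> SEP ds \<and> mtrace (avg_state ds n \<eta> \<rho> * M) = 1}"

text \<open>
  If the average state is singular, the values need not have a maximum. For two qubits, with
  \<open>\<psi>\<^sub>\<plusminus> = (|01\<rangle> \<plusminus> |10\<rangle>) / \<surd>2\<close>, take \<open>\<eta>\<^sub>1 = \<eta>\<^sub>2 = 1/2\<close>, \<open>\<rho>\<^sub>1 = |\<psi>\<^sub>+\<rangle>\<langle>\<psi>\<^sub>+|\<close> and
  \<open>\<rho>\<^sub>2 = (|\<psi>\<^sub>-\<rangle>\<langle>\<psi>\<^sub>-| + |11\<rangle>\<langle>11|) / 2\<close>. For \<open>j = 1\<close> the product vectors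
  \<open>(|0\<rangle> + \<epsilon>|1\<rangle>) \<otimes> (|0\<rangle> + \<epsilon>|1\<rangle>)\<close> give values tending to 1 as \<open>\<epsilon> \<rightarrow> 0\<close>, but 1 is not attained:
  every product vector orthogonal to \<open>\<psi>\<^sub>-\<close> and \<open>|11\<rangle>\<close> is orthogonal to \<open>\<psi>\<^sub>+\<close>. The maximal
  confidences are therefore suprema (all values lie in the unit interval), and
  attainment is expressed separately by \<open>is_maximum\<close>.
\<close>

definition max_conf_sep :: "nat list \<Rightarrow> nat \<Rightarrow> (nat \<Rightarrow> real) \<Rightarrow> (nat \<Rightarrow> complex mat) \<Rightarrow> nat \<Rightarrow> real" where
  "max_conf_sep ds n \<eta> \<rho> j = Sup (sep_values ds n \<eta> \<rho> j)"

definition max_conf_locc :: "nat list \<Rightarrow> nat \<Rightarrow> (nat \<Rightarrow> real) \<Rightarrow> (nat \<Rightarrow> complex mat) \<Rightarrow> nat \<Rightarrow> real" where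
  "max_conf_locc ds n \<eta> \<rho> j = Sup (locc_values ds n \<eta> \<rho> j)"

definition is_maximum :: "real set \<Rightarrow> real \<Rightarrow> bool" where
  "is_maximum A v \<longleftrightarrow> v \<in> A \<and> (\<forall>x \<in> A. x \<le> v)"

end

theory Submission
  imports
    "HOL-Analysis.Function_Topology"
    "HOL-Analysis.Convex"
    "HOL-Analysis.Topology_Euclidean_Space"
    Defs
begin

text \<open>
  All three sets of values coincide. An LOCC measurement is separable because the POVM element of an
  outcome is obtained by pulling the identity back through local Kraus operators, which maps
  product operators to product operators. A separable \<open>M\<^sub>j\<close> can be rescaled so that its trace against
  the average state is 1, which does not change the confidence. Conversely,
  \<open>M = \<Sum> p\<^sub>l \<sigma>\<^sub>l\<close> with product states \<open>\<sigma>\<^sub>l\<close> is implemented up to the factor \<open>1 / \<Sum> p\<^sub>l\<close>: draw \<open>l\<close> with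
  probability proportional to \<open>p\<^sub>l\<close>, let each party perform the two-outcome measurement
  whose first element is its factor of \<open>\<sigma>\<^sub>l\<close>, and output \<open>j\<close> if all of them succeed, 0 otherwise.

  For an invertible average state, the ratio of the two traces is continuous on the compact set of
  product states, and its maximum there bounds the value of every separable operator, since the
  value is a mediant of the ratios of the product terms.
\<close>

section \<open>Positive semidefinite matrices\<close>

text \<open>Positivity is used throughout by way of a factor, \<open>A = mat_adjoint K * K\<close>.
  This one fact turns traces of products into sums of squares, makes Kronecker products positive,
  supplies the Kraus operators of the local tests and gives compact coordinates for the local
  states. The confidence for \<open>j\<close> sees only \<open>M j\<close>, and that only up to a
  positive factor. Hence a protocol may succeed with small probability and declare every other
  result inconclusive. A local test with first element \<sigma> exists because unit trace forses the
  eigenvalues of a state to be at most 1. An LOCC measurement is given by its outcome probabilities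
  on states, so identifying it with the pulled-back operators requires that states separate
  matrices. Invertibility enters through the denominator: it keeps the trace against the average
  state positive on all product states. Otherwise a supremum may be approached only towards a
  product state where both traces vanish, such as the limit of the vectors in the two-qubit
  example.\<close>

lemma dim_mat_adjoint [simp]:
  "dim_row (mat_adjoint A) = dim_col A" "dim_col (mat_adjoint A) = dim_row A"
  unfolding mat_adjoint_def by auto

lemma mat_adjoint_index [simp]:
  fixes A :: "complex mat"
  assumes "i < dim_col A" "j < dim_row A"
  shows "mat_adjoint A $$ (i, j) = cnj (A $$ (j, i))"
  using assms by (simp add: mat_adjoint_def mat_of_rows_def)

lemma mat_adjoint_carrier [simp]: "A \<in> carrier_mat m n \<Longrightarrow> mat_adjoint A \<in> carrier_mat n m"
  by (metis carrier_matI carrier_matD dim_mat_adjoint)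

lemma index_mult_mat_sum:
  assumes "A \<in> carrier_mat m n" "B \<in> carrier_mat n p" "i < m" "j < p"
  shows "(A * B) $$ (i, j) = (\<Sum>k<n. A $$ (i, k) * B $$ (k, j))"
  using assms by (auto simp: scalar_prod_def atLeast0LessThan)

lemma mat_adjoint_adjoint [simp]: "mat_adjoint (mat_adjoint A) = (A :: complex mat)"
  by (rule eq_matI) auto

lemma mat_adjoint_one [simp]: "mat_adjoint (1\<^sub>m d) = (1\<^sub>m d :: complex mat)"
  by (rule eq_matI) auto

lemma mat_adjoint_mult:
  fixes A B :: "complex mat"
  assumes "A \<in> carrier_mat m n" "B \<in> carrier_mat n p"
  shows "mat_adjoint (A * B) = mat_adjoint B * mat_adjoint A"
proof (rule eq_matI, goal_cases)
  case (1 i j)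
  with assms have ij: "i < p" "j < m" by auto
  have "mat_adjoint (A * B) $$ (i, j) = cnj ((A * B) $$ (j, i))"
    using assms ij by simp
  also have "\<dots> = (\<Sum>k<n. cnj (A $$ (j, k)) * cnj (B $$ (k, i)))"
    using assms ij by (subst index_mult_mat_sum) auto
  also have "\<dots> = (mat_adjoint B * mat_adjoint A) $$ (i, j)"
    using assms ij
    by (subst index_mult_mat_sum[where m = p and n = n and p = m]) (auto simp: mult.commute)
  finally show ?case .
qed (use assms in auto)

lemma mat_adjoint_gram:
  fixes A :: "complex mat"
  shows "mat_adjoint (mat_adjoint A * A) = mat_adjoint A * A"
  by (simp add: mat_adjoint_mult[of "mat_adjoint A" "dim_col A" "dim_row A" A "dim_col A"])

lemma cnj_mult_cmod: "cnj z * z = complex_of_real ((cmod z)\<^sup>2)"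
  by (simp only: complex_norm_square mult.commute)

section \<open>Traces of products\<close>

lemma mtrace_mult:
  assumes "A \<in> carrier_mat m n" "B \<in> carrier_mat n m"
  shows "mtrace (A * B) = (\<Sum>i<m. \<Sum>j<n. A $$ (i, j) * B $$ (j, i))"
  using assms unfolding mtrace_def
  by (intro sum.cong) (auto simp: scalar_prod_def atLeast0LessThan)

lemma mtrace_comm:
  assumes "A \<in> carrier_mat m n" "B \<in> carrier_mat n m"
  shows "mtrace (A * B) = mtrace (B * A)"
  by (subst mtrace_mult[OF assms], subst mtrace_mult[OF assms(2,1)], subst sum.swap)
    (simp add: mult.commute)

lemma mtrace_gram:
  assumes "K \<in> carrier_mat m d"
  shows "mtrace (mat_adjoint K * K) = complex_of_real (\<Sum>i<m. \<Sum>j<d. (cmod (K $$ (i, j)))\<^sup>2)"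
proof -
  have "mtrace (mat_adjoint K * K) = (\<Sum>j<d. \<Sum>i<m. mat_adjoint K $$ (j, i) * K $$ (i, j))"
    using assms by (intro mtrace_mult) auto
  also have "\<dots> = (\<Sum>j<d. \<Sum>i<m. complex_of_real ((cmod (K $$ (i, j)))\<^sup>2))"
    using assms by (intro sum.cong refl) (simp only: cnj_mult_cmod mat_adjoint_index carrier_matD lessThan_iff)
  also have "\<dots> = (\<Sum>i<m. \<Sum>j<d. complex_of_real ((cmod (K $$ (i, j)))\<^sup>2))"
    by (rule sum.swap)
  finally show ?thesis by simp
qed

text \<open>The argument is a plain function, so that test vectors can be written by cases without
  carrier conditions; its values from \<open>d\<close> on are ignored.\<close>

definition quad_form :: "nat \<Rightarrow> complex mat \<Rightarrow> (nat \<Rightarrow> complex) \<Rightarrow> complex" where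
  "quad_form d A v = (\<Sum>i<d. \<Sum>j<d. cnj (v i) * A $$ (i, j) * v j)"

lemma cscalar_prod_quad_form:
  assumes "A \<in> carrier_mat d d" "v \<in> carrier_vec d"
  shows "(A *\<^sub>v v) \<bullet>c v = quad_form d A (\<lambda>i. v $ i)"
  using assms unfolding quad_form_def
  by (auto simp: scalar_prod_def atLeast0LessThan sum_distrib_left sum_distrib_right mult_ac
      intro!: sum.cong)

lemma psd_iff:
  "psd d A \<longleftrightarrow> A \<in> carrier_mat d d \<and> mat_adjoint A = A \<and> (\<forall>v. 0 \<le> quad_form d A v)"
proof -
  have "quad_form d A v = (A *\<^sub>v Matrix.vec d v) \<bullet>c Matrix.vec d v" if "A \<in> carrier_mat d d" for v
    using that by (subst cscalar_prod_quad_form) (auto simp: quad_form_def)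
  then show ?thesis unfolding psd_def
    by (metis cscalar_prod_quad_form vec_carrier)
qed

lemma psd_carrier: "psd d A \<Longrightarrow> A \<in> carrier_mat d d"
  by (simp add: psd_def)

lemma psd_hermitian_index: "psd d A \<Longrightarrow> i < d \<Longrightarrow> j < d \<Longrightarrow> cnj (A $$ (i, j)) = A $$ (j, i)"
  by (metis carrier_matD mat_adjoint_index psd_def)

text \<open>The form of a Gram matrix at \<open>v\<close> is the squared norm of
  \<open>K v\<close>.\<close>

lemma quad_form_gram:
  assumes "K \<in> carrier_mat m d"
  shows "quad_form d (mat_adjoint K * K) v
    = complex_of_real (\<Sum>k<m. (cmod (\<Sum>i<d. K $$ (k, i) * v i))\<^sup>2)"
proof -
  have "quad_form d (mat_adjoint K * K) v
      = (\<Sum>i<d. \<Sum>j<d. \<Sum>k<m. cnj (K $$ (k, i) * v i) * (K $$ (k, j) * v j))"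
    unfolding quad_form_def using assms
    by (intro sum.cong refl, subst index_mult_mat_sum)
      (auto simp: sum_distrib_left sum_distrib_right mult_ac)
  also have "\<dots> = (\<Sum>k<m. \<Sum>i<d. \<Sum>j<d. cnj (K $$ (k, i) * v i) * (K $$ (k, j) * v j))"
    by (subst sum.swap[of _ "{..<d}" "{..<m}"], subst (2) sum.swap) (rule refl)
  also have "\<dots> = (\<Sum>k<m. cnj (\<Sum>i<d. K $$ (k, i) * v i) * (\<Sum>j<d. K $$ (k, j) * v j))"
    by (simp add: sum_product)
  also have "\<dots> = (\<Sum>k<m. complex_of_real ((cmod (\<Sum>i<d. K $$ (k, i) * v i))\<^sup>2))"
    by (simp only: cnj_mult_cmod)
  finally show ?thesis by simp
qed

lemma psd_gram:
  assumes "K \<in> carrier_mat m d"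
  shows "psd d (mat_adjoint K * K)"
proof -
  have "0 \<le> quad_form d (mat_adjoint K * K) v" for v
    unfolding quad_form_gram[OF assms] by (auto simp: less_eq_complex_def intro!: sum_nonneg)
  then show ?thesis
    using assms by (auto simp: psd_iff mat_adjoint_gram)
qed

lemma sum_if_pair:
  fixes f :: "nat \<Rightarrow> complex"
  assumes "p < d" "q < d" "p \<noteq> q"
  shows "(\<Sum>i<d. (if i = p then a else if i = q then b else 0) * f i) = a * f p + b * f q"
proof -
  have "(\<Sum>i<d. (if i = p then a else if i = q then b else 0) * f i)
      = (\<Sum>i<d. (if i = p then a * f i else 0) + (if i = q then b * f i else 0))"
    using assms by (intro sum.cong) auto
  then show ?thesis using assms by (simp add: sum.distrib)
qed

lemma quad_form_pair:
  assumes "p < d" "q < d" "p \<noteq> q"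
  shows "quad_form d A (\<lambda>i. if i = p then a else if i = q then b else 0)
    = cnj a * a * A $$ (p, p) + cnj a * b * A $$ (p, q) + cnj b * a * A $$ (q, p)
      + cnj b * b * A $$ (q, q)"
proof -
  let ?v = "\<lambda>i. if i = p then a else if i = q then b else 0"
  let ?w = "\<lambda>i. if i = p then cnj a else if i = q then cnj b else 0"
  have "quad_form d A ?v = (\<Sum>i<d. ?w i * (\<Sum>j<d. ?v j * A $$ (i, j)))"
    unfolding quad_form_def
    by (auto simp: sum_distrib_left mult_ac intro!: sum.cong)
  also have "\<dots> = (\<Sum>i<d. ?w i * (a * A $$ (i, p) + b * A $$ (i, q)))"
    by (simp only: sum_if_pair[OF assms])
  also have "\<dots> = cnj a * (a * A $$ (p, p) + b * A $$ (p, q))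
      + cnj b * (a * A $$ (q, p) + b * A $$ (q, q))"
    by (simp only: sum_if_pair[OF assms])
  finally show ?thesis by (simp add: algebra_simps)
qed

lemma quad_form_single:
  assumes "p < d"
  shows "quad_form d A (\<lambda>i. if i = p then 1 else 0) = A $$ (p, p)"
proof -
  have "quad_form d A (\<lambda>i. if i = p then 1 else 0)
    = (\<Sum>i<d. if i = p then (\<Sum>j<d. if j = p then A $$ (i, j) else 0) else 0)"
    unfolding quad_form_def by (intro sum.cong refl) (auto intro!: sum.cong simp: if_distrib cong: if_cong)
  then show ?thesis using assms by simp
qed

text \<open>Polarisation: unit vectors give the diagonal, and two combinations of a pair of unit
  vectors give the sum and the difference of the opposite off-diagonal entries.\<close>

lemma mat_eq_quad_formI:
  assumes A: "A \<in> carrier_mat d d" and B: "B \<in> carrier_mat d d"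
    and eq: "\<And>v. quad_form d A v = quad_form d B v"
  shows "A = B"
proof (rule eq_matI, goal_cases)
  case (1 p q)
  with B have pq: "p < d" "q < d" by auto
  have diag: "A $$ (r, r) = B $$ (r, r)" if "r < d" for r
    using eq[of "\<lambda>i. if i = r then 1 else 0"] that by (simp only: quad_form_single)
  show ?case
  proof (cases "p = q")
    case False
    from eq[of "\<lambda>i. if i = p then 1 else if i = q then 1 else 0"]
    have "A $$ (p, q) + A $$ (q, p) = B $$ (p, q) + B $$ (q, p)"
      unfolding quad_form_pair[OF pq False] using diag pq by simp
    \<comment> \<open>The phase \<i> gives the two off-diagonal entries opposite signs.\<close>
    moreover from eq[of "\<lambda>i. if i = p then 1 else if i = q then \<i> else 0"]
    have "\<i> * (A $$ (p, q) - A $$ (q, p)) = \<i> * (B $$ (p, q) - B $$ (q, p))"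
      unfolding quad_form_pair[OF pq False] using diag pq by (simp add: algebra_simps)
    then have "A $$ (p, q) - A $$ (q, p) = B $$ (p, q) - B $$ (q, p)" by simp
    ultimately have "(A $$ (p, q) + A $$ (q, p)) + (A $$ (p, q) - A $$ (q, p))
        = (B $$ (p, q) + B $$ (q, p)) + (B $$ (p, q) - B $$ (q, p))"
      by (rule arg_cong2)
    then have "2 * A $$ (p, q) = 2 * B $$ (p, q)" by simp
    then show ?thesis by simp
  qed (use diag pq in simp)
qed (use A B in auto)

lemma psd_diag: "psd d A \<Longrightarrow> i < d \<Longrightarrow> 0 \<le> A $$ (i, i)"
  by (metis psd_iff quad_form_single)

lemma psd_zero_diag:
  assumes A: "psd d A" and zero: "\<And>i. i < d \<Longrightarrow> A $$ (i, i) = 0"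
  shows "A = 0\<^sub>m d d"
proof (rule eq_matI, goal_cases)
  case (1 p q)
  then have pq: "p < d" "q < d" by auto
  show ?case
  proof (cases "p = q")
    case False
    \<comment> \<open>With zero diagonal only the cross terms survive; this coefficient makes both
      of them equal to minus the squared modulus of the entry.\<close>
    let ?c = "- A $$ (p, q)"
    have "0 \<le> quad_form d A (\<lambda>i. if i = p then ?c else if i = q then 1 else 0)"
      using A by (simp only: psd_iff)
    also have "\<dots> = - 2 * (cnj (A $$ (p, q)) * A $$ (p, q))"
      unfolding quad_form_pair[OF pq False] using zero pq psd_hermitian_index[OF A pq]
      by (simp add: algebra_simps)
    also have "\<dots> = complex_of_real (- 2 * (cmod (A $$ (p, q)))\<^sup>2)"
      by (simp add: cnj_mult_cmod)
    finally show ?thesis using pq by (simp add: less_eq_complex_def)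
  qed (use zero pq in simp)
qed (use psd_carrier[OF A] in auto)

lemma mat_mult_assoc_dim:
  "dim_col A = dim_row B \<Longrightarrow> dim_col B = dim_row C \<Longrightarrow> A * B * C = A * (B * (C :: complex mat))"
  by (rule assoc_mult_mat[of _ "dim_row A" "dim_col A" _ "dim_col B" _ "dim_col C"]) auto

text \<open>The form of the complement at \<open>v\<close> is the form of \<open>A\<close> at a
  vector \<open>w\<close> that differs from \<open>v\<close> only in coordinate \<open>k\<close>,
  chosen such that \<open>A w\<close> vanishes there.\<close>

lemma psd_schur_complement:
  assumes A: "psd d A" and k: "k < d" and nz: "A $$ (k, k) \<noteq> 0"
  shows "psd d (mat d d (\<lambda>(i, j). A $$ (i, j) - A $$ (i, k) * A $$ (k, j) / A $$ (k, k)))"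
    (is "psd d ?A'")
proof -
  have herm: "cnj (A $$ (i, j)) = A $$ (j, i)" if "i < d" "j < d" for i j
    using psd_hermitian_index[OF A that] .
  have "0 \<le> quad_form d ?A' v" for v
  proof -
    define S where "S = (\<Sum>j<d. A $$ (k, j) * v j)"
    define t where "t = S / A $$ (k, k)"
    \<comment> \<open>The shift \<open>t\<close> solves the equation that coordinate
      \<open>k\<close> of \<open>A w\<close> is zero. As \<open>R\<close> is \<open>A w\<close>, the
      conjugated factor \<open>w i\<close> can then be replaced by \<open>v i\<close>.\<close>
    define w where "w = (\<lambda>i. v i - (if i = k then t else 0))"
    define R where "R = (\<lambda>i. \<Sum>j<d. A $$ (i, j) * w j)"
    have cnj_S: "cnj S = (\<Sum>i<d. cnj (v i) * A $$ (i, k))"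
      unfolding S_def cnj_sum complex_cnj_mult using k herm
      by (intro sum.cong) (auto simp: mult.commute)
    have R: "R i = (\<Sum>j<d. A $$ (i, j) * v j) - A $$ (i, k) * t" for i
    proof -
      have "R i = (\<Sum>j<d. A $$ (i, j) * v j - (if j = k then A $$ (i, k) * t else 0))"
        unfolding R_def w_def by (intro sum.cong) (auto simp: algebra_simps)
      then show ?thesis using k by (simp add: sum_subtractf)
    qed
    have Rk: "R k = 0"
      using nz by (simp add: R S_def[symmetric] t_def)
    have "quad_form d A w = (\<Sum>i<d. cnj (w i) * R i)"
      unfolding quad_form_def R_def by (simp add: sum_distrib_left mult.assoc)
    also have "\<dots> = (\<Sum>i<d. cnj (v i) * R i)"
      by (intro sum.cong) (auto simp: w_def Rk)
    also have "\<dots> = quad_form d A v - cnj S * t"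
      unfolding R cnj_S quad_form_def
      by (simp add: right_diff_distrib sum_subtractf sum_distrib_left sum_distrib_right mult.assoc)
    also have "\<dots> = quad_form d ?A' v"
    proof -
      have "quad_form d ?A' v = (\<Sum>i<d. \<Sum>j<d. cnj (v i) * A $$ (i, j) * v j
          - cnj (v i) * A $$ (i, k) * (A $$ (k, j) * v j) / A $$ (k, k))"
        unfolding quad_form_def
        by (intro sum.cong) (auto simp: algebra_simps)
      also have "\<dots> = quad_form d A v
          - (\<Sum>i<d. \<Sum>j<d. cnj (v i) * A $$ (i, k) * (A $$ (k, j) * v j)) / A $$ (k, k)"
        by (simp add: sum_subtractf sum_divide_distrib quad_form_def)
      also have "(\<Sum>i<d. \<Sum>j<d. cnj (v i) * A $$ (i, k) * (A $$ (k, j) * v j)) = cnj S * S"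
        unfolding cnj_S by (simp only: S_def sum_product)
      finally show ?thesis by (simp add: t_def)
    qed
    finally show ?thesis using A by (metis psd_iff)
  qed
  moreover have "mat_adjoint ?A' = ?A'"
    using herm k by (intro eq_matI) (auto simp: mult.commute)
  ultimately show ?thesis by (auto simp: psd_iff)
qed

text \<open>
  A Cholesky factorisation, one Schur complement at a time: the eliminated pivot goes into a row of
  the factor that is still zero.
\<close>

lemma psd_factor_aux:
  assumes "k \<le> d" "psd d A" "\<And>i. k \<le> i \<Longrightarrow> i < d \<Longrightarrow> A $$ (i, i) = 0"
  shows "\<exists>K \<in> carrier_mat d d. A = mat_adjoint K * K
    \<and> (\<forall>r j. k \<le> r \<longrightarrow> r < d \<longrightarrow> j < d \<longrightarrow> K $$ (r, j) = 0)"
  using assms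
proof (induction k arbitrary: A)
  case 0
  then have "A = 0\<^sub>m d d" by (intro psd_zero_diag) auto
  moreover have "mat_adjoint (0\<^sub>m d d) * 0\<^sub>m d d = (0\<^sub>m d d :: complex mat)"
    by (intro right_mult_zero_mat) simp
  ultimately show ?case by (intro bexI[of _ "0\<^sub>m d d"]) auto
next
  case (Suc k)
  then have k: "k < d" by simp
  note A = \<open>psd d A\<close>
  show ?case
  proof (cases "A $$ (k, k) = 0")
    case True
    then have "A $$ (i, i) = 0" if "k \<le> i" "i < d" for i
      using Suc.prems(3)[of i] that by (cases "i = k") auto
    with Suc.IH[of A] k A show ?thesis by (metis Suc_leD less_imp_le)
  next
    case False
    define A' where "A' = mat d d (\<lambda>(i, j). A $$ (i, j) - A $$ (i, k) * A $$ (k, j) / A $$ (k, k))"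
    have A': "psd d A'" unfolding A'_def by (rule psd_schur_complement[OF A k False])
    obtain \<alpha> where \<alpha>: "A $$ (k, k) = complex_of_real \<alpha>" "0 < \<alpha>"
    proof
      show "A $$ (k, k) = complex_of_real (Re (A $$ (k, k)))" "0 < Re (A $$ (k, k))"
        using psd_diag[OF A k] False by (auto simp: less_eq_complex_def complex_eq_iff)
    qed
    have sq: "A $$ (i, k) * A $$ (k, i) = complex_of_real ((cmod (A $$ (k, i)))\<^sup>2)" if "i < d" for i
      using psd_hermitian_index[OF A k that] cnj_mult_cmod[of "A $$ (k, i)"] by simp
    \<comment> \<open>Past the pivot the diagonal of \<open>A\<close> is already zero, so
      subtraction can only make these entries nonpositive, while positivity of the complement makes
      them nonnegative.\<close>
    have "A' $$ (i, i) = 0" if "k \<le> i" "i < d" for i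
    proof (cases "i = k")
      case True
      then show ?thesis using that False by (simp add: A'_def)
    next
      case False
      with that Suc.prems(3)[of i] have "A' $$ (i, i) = complex_of_real (- (cmod (A $$ (k, i)))\<^sup>2 / \<alpha>)"
        by (simp add: A'_def sq \<alpha>(1))
      moreover have "0 \<le> A' $$ (i, i)" using psd_diag[OF A' that(2)] .
      ultimately show ?thesis using \<alpha>(2) by (simp add: less_eq_complex_def divide_le_0_iff zero_le_divide_iff)
    qed
    with Suc.IH[of A'] A' k obtain K' where K': "K' \<in> carrier_mat d d" "A' = mat_adjoint K' * K'"
      and zero: "\<And>r j. k \<le> r \<Longrightarrow> r < d \<Longrightarrow> j < d \<Longrightarrow> K' $$ (r, j) = 0"
      by auto
    define K where
      "K = mat d d (\<lambda>(r, j). if r = k then A $$ (k, j) / complex_of_real (sqrt \<alpha>) else K' $$ (r, j))"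
    have K: "K \<in> carrier_mat d d" by (simp add: K_def)
    have "A = mat_adjoint K * K"
    proof (rule eq_matI, goal_cases)
      case (1 i j)
      with K have ij: "i < d" "j < d" by auto
      have "A' $$ (i, j) = (\<Sum>r<d. cnj (K' $$ (r, i)) * K' $$ (r, j))"
        unfolding K'(2) using K' ij by (subst index_mult_mat_sum[of _ d d _ d]) auto
      also have "\<dots> = (\<Sum>r\<in>{..<d} - {k}. cnj (K' $$ (r, i)) * K' $$ (r, j))"
        using k ij zero by (subst sum.remove[of _ k]) auto
      also have "\<dots> = (\<Sum>r\<in>{..<d} - {k}. cnj (K $$ (r, i)) * K $$ (r, j))"
        using ij by (intro sum.cong) (auto simp: K_def)
      finally have rest: "(\<Sum>r\<in>{..<d} - {k}. cnj (K $$ (r, i)) * K $$ (r, j)) = A' $$ (i, j)" ..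
      have pivot: "cnj (K $$ (k, i)) * K $$ (k, j) = A $$ (i, k) * A $$ (k, j) / A $$ (k, k)"
      proof -
        have "complex_of_real (sqrt \<alpha>) * complex_of_real (sqrt \<alpha>) = complex_of_real \<alpha>"
          using \<alpha>(2) by (simp flip: of_real_mult)
        then show ?thesis
          using k ij psd_hermitian_index[OF A k ij(1)] by (simp add: K_def \<alpha>(1))
      qed
      have "(mat_adjoint K * K) $$ (i, j) = (\<Sum>r<d. cnj (K $$ (r, i)) * K $$ (r, j))"
        using K ij by (subst index_mult_mat_sum[of _ d d _ d]) auto
      also have "\<dots> = cnj (K $$ (k, i)) * K $$ (k, j) + A' $$ (i, j)"
        using k by (subst sum.remove[of _ k]) (auto simp: rest)
      also have "\<dots> = A $$ (i, j)" using ij by (simp add: pivot A'_def)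
      finally show ?case ..
    qed (use K psd_carrier[OF A] in auto)
    moreover have "K $$ (r, j) = 0" if "Suc k \<le> r" "r < d" "j < d" for r j
      using that zero by (simp add: K_def)
    ultimately show ?thesis using K by blast
  qed
qed

lemma psd_factor:
  assumes "psd d A"
  obtains K where "K \<in> carrier_mat d d" "A = mat_adjoint K * K"
  using psd_factor_aux[of d d A] assms by auto

section \<open>Closure properties and traces of positive semidefinite matrices\<close>

lemma psd_congruence:
  assumes "psd d A" "X \<in> carrier_mat d e"
  shows "psd e (mat_adjoint X * A * X)"
proof -
  obtain K where K: "K \<in> carrier_mat d d" "A = mat_adjoint K * K"
    using psd_factor[OF assms(1)] .
  have "mat_adjoint X * A * X = mat_adjoint (K * X) * (K * X)"
    using carrier_matD[OF K(1)] carrier_matD[OF assms(2)]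
    by (simp add: K(2) mat_adjoint_mult[OF K(1) assms(2)] mat_mult_assoc_dim)
  then show ?thesis using K assms psd_gram[of "K * X" d e] by simp
qed

lemma quad_form_add:
  assumes "A \<in> carrier_mat d d" "B \<in> carrier_mat d d"
  shows "quad_form d (A + B) v = quad_form d A v + quad_form d B v"
  using assms unfolding quad_form_def sum.distrib[symmetric]
  by (intro sum.cong) (auto simp: algebra_simps)

lemma quad_form_smult:
  assumes "A \<in> carrier_mat d d"
  shows "quad_form d (c \<cdot>\<^sub>m A) v = c * quad_form d A v"
  using assms unfolding quad_form_def sum_distrib_left
  by (intro sum.cong) (auto simp: algebra_simps)

lemma psd_add:
  assumes "psd d A" "psd d B"
  shows "psd d (A + B)"
proof -
  note carr = assms[THEN psd_carrier]
  have "mat_adjoint (A + B) = A + B"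
    using carr assms[THEN psd_hermitian_index] by (intro eq_matI) auto
  then show ?thesis using assms carr by (auto simp: psd_iff quad_form_add)
qed

lemma psd_smult:
  assumes "psd d A" "0 \<le> p"
  shows "psd d (complex_of_real p \<cdot>\<^sub>m A)"
proof -
  note carr = assms(1)[THEN psd_carrier]
  have "mat_adjoint (complex_of_real p \<cdot>\<^sub>m A) = complex_of_real p \<cdot>\<^sub>m A"
    using carr assms(1)[THEN psd_hermitian_index] by (intro eq_matI) auto
  moreover have "0 \<le> complex_of_real p" using assms(2) by (simp add: less_eq_complex_def)
  ultimately show ?thesis using assms carr
    by (auto simp: psd_iff quad_form_smult intro!: mult_nonneg_nonneg)
qed

lemma psd_zero [simp]: "psd d (0\<^sub>m d d)"
proof -
  have "mat_adjoint (0\<^sub>m d d) = (0\<^sub>m d d :: complex mat)" by (rule eq_matI) auto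
  then show ?thesis by (simp add: psd_iff quad_form_def)
qed

lemma psd_one [simp]: "psd d (1\<^sub>m d)"
  using psd_gram[of "1\<^sub>m d" d d] by simp

text \<open>With factors \<open>K\<close> of \<open>A\<close> and \<open>L\<close> of
  \<open>B\<close>, cyclicity turns the trace into the squared Frobenius norm of
  \<open>K * mat_adjoint L\<close>. This matrix is also the middle part of \<open>A * B\<close>, so
  a vanishing norm kills the product.\<close>

lemma psd_mtrace_mult:
  assumes "psd d A" "psd d B"
  shows "0 \<le> mtrace (A * B)" and "mtrace (A * B) = 0 \<Longrightarrow> A * B = 0\<^sub>m d d"
proof -
  obtain K where K: "K \<in> carrier_mat d d" "A = mat_adjoint K * K"
    using psd_factor[OF assms(1)] .
  obtain L where L: "L \<in> carrier_mat d d" "B = mat_adjoint L * L"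
    using psd_factor[OF assms(2)] .
  let ?X = "K * mat_adjoint L"
  have X: "?X \<in> carrier_mat d d" using K L by simp
  have "mtrace (A * B) = mtrace ((A * mat_adjoint L) * L)"
    using carrier_matD[OF K(1)] carrier_matD[OF L(1)] by (simp add: K(2) L(2) mat_mult_assoc_dim)
  also have "\<dots> = mtrace (L * (A * mat_adjoint L))"
    using K L by (intro mtrace_comm[of _ d d]) auto
  also have "L * (A * mat_adjoint L) = mat_adjoint ?X * ?X"
    using K(1) L(1) carrier_matD[OF K(1)] carrier_matD[OF L(1)]
    by (simp add: K(2) mat_adjoint_mult[of K d d _ d] mat_mult_assoc_dim)
  finally have tr: "mtrace (A * B) = complex_of_real (\<Sum>i<d. \<Sum>j<d. (cmod (?X $$ (i, j)))\<^sup>2)"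
    by (simp only: mtrace_gram[OF X])
  show "0 \<le> mtrace (A * B)"
    unfolding tr by (auto simp: less_eq_complex_def intro!: sum_nonneg)
  show "A * B = 0\<^sub>m d d" if "mtrace (A * B) = 0"
  proof -
    have "(\<Sum>i<d. \<Sum>j<d. (cmod (?X $$ (i, j)))\<^sup>2) = 0" using that unfolding tr of_real_eq_0_iff .
    then have "?X $$ (i, j) = 0" if "i < d" "j < d" for i j
      using that by (simp add: sum_nonneg_eq_0_iff sum_nonneg)
    then have "?X = 0\<^sub>m d d" using K L by (intro eq_matI) auto
    moreover have "A * B = mat_adjoint K * ?X * L"
      using carrier_matD[OF K(1)] carrier_matD[OF L(1)] by (simp add: K(2) L(2) mat_mult_assoc_dim)
    ultimately show ?thesis using K L by simp
  qed
qed

lemma psd_mtrace: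
  assumes "psd d A"
  shows "0 \<le> mtrace A" and "mtrace A = 0 \<Longrightarrow> A = 0\<^sub>m d d"
  using psd_mtrace_mult[OF assms psd_one] psd_carrier[OF assms] by auto

lemma mtrace_smult: "mtrace (c \<cdot>\<^sub>m A) = c * mtrace A" if "A \<in> carrier_mat d d"
  using that by (auto simp: mtrace_def sum_distrib_left)

lemma psd_normalize:
  assumes "0 < d" "psd d A"
  obtains p \<sigma> where "0 \<le> p" "state d \<sigma>" "A = complex_of_real p \<cdot>\<^sub>m \<sigma>"
proof -
  have *: "\<exists>p \<sigma>. 0 < p \<and> state d \<sigma> \<and> B = complex_of_real p \<cdot>\<^sub>m \<sigma>"
    if B: "psd d B" "mtrace B \<noteq> 0" for B
  proof -
    obtain p where p: "mtrace B = complex_of_real p" "0 < p"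
      using psd_mtrace(1)[OF B(1)] B(2)
      by (intro that[of "Re (mtrace B)"]) (auto simp: less_eq_complex_def complex_eq_iff)
    define \<sigma> where "\<sigma> = complex_of_real (1 / p) \<cdot>\<^sub>m B"
    have "state d \<sigma>"
      unfolding \<sigma>_def state_def using p B psd_smult[of d B "1 / p"] psd_carrier[OF B(1)]
      by (simp add: mtrace_smult[of _ d])
    moreover have "B = complex_of_real p \<cdot>\<^sub>m \<sigma>"
      using psd_carrier[OF B(1)] p unfolding \<sigma>_def by (intro eq_matI) auto
    ultimately show ?thesis using p by blast
  qed
  show ?thesis
  proof (cases "mtrace A = 0")
    case True
    \<comment> \<open>The zero matrix has no normalisation of its own. It gets weight 0 and an
      arbitrary state, here the normalised identity, which exists as \<open>d\<close> is
      positive.\<close>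
    have "mtrace (1\<^sub>m d) \<noteq> (0 :: complex)" using assms(1) by (simp add: mtrace_def)
    with *[OF psd_one] obtain \<sigma> where \<sigma>: "state d \<sigma>" by auto
    moreover have "A = complex_of_real 0 \<cdot>\<^sub>m \<sigma>"
      using psd_mtrace(2)[OF assms(2) True] psd_carrier[of d \<sigma>] \<sigma>
      by (intro eq_matI) (auto simp: state_def)
    ultimately show ?thesis using that[of 0 \<sigma>] by simp
  next
    case False
    then show ?thesis using *[OF assms(2)] that by (meson less_imp_le)
  qed
qed

text \<open>Cauchy-Schwarz in each row bounds the squared norm of \<open>K v\<close> by that of
  \<open>v\<close> times the squared Frobenius norm of \<open>K\<close>, which is the trace of
  \<sigma>. Thus a state can serve as one element of a two-outcome measurement.\<close>

lemma state_complement_psd: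
  assumes "state d \<sigma>"
  shows "psd d (1\<^sub>m d - \<sigma>)"
proof -
  have \<sigma>: "psd d \<sigma>" "mtrace \<sigma> = 1" using assms by (auto simp: state_def)
  obtain K where K: "K \<in> carrier_mat d d" "\<sigma> = mat_adjoint K * K"
    using psd_factor[OF \<sigma>(1)] .
  have tr: "(\<Sum>i<d. \<Sum>j<d. (cmod (K $$ (i, j)))\<^sup>2) = 1"
    using \<sigma>(2) unfolding K(2) mtrace_gram[OF K(1)] of_real_eq_1_iff .
  have "0 \<le> quad_form d (1\<^sub>m d - \<sigma>) v" for v
  proof -
    have one: "quad_form d (1\<^sub>m d) v = complex_of_real (\<Sum>i<d. (cmod (v i))\<^sup>2)"
    proof -
      have "quad_form d (1\<^sub>m d) v = (\<Sum>i<d. \<Sum>j<d. if i = j then cnj (v i) * v i else 0)"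
        unfolding quad_form_def by (intro sum.cong) auto
      then show ?thesis by (simp add: cnj_mult_cmod)
    qed
    have gram: "quad_form d \<sigma> v = complex_of_real (\<Sum>k<d. (cmod (\<Sum>i<d. K $$ (k, i) * v i))\<^sup>2)"
      unfolding K(2) by (rule quad_form_gram[OF K(1)])
    have "(\<Sum>k<d. (cmod (\<Sum>i<d. K $$ (k, i) * v i))\<^sup>2)
        \<le> (\<Sum>k<d. (\<Sum>i<d. (cmod (K $$ (k, i)))\<^sup>2) * (\<Sum>i<d. (cmod (v i))\<^sup>2))"
    proof (rule sum_mono)
      fix k
      have "cmod (\<Sum>i<d. K $$ (k, i) * v i) \<le> (\<Sum>i<d. cmod (K $$ (k, i)) * cmod (v i))"
        by (rule order_trans[OF norm_sum]) (simp add: norm_mult)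
      then have "(cmod (\<Sum>i<d. K $$ (k, i) * v i))\<^sup>2 \<le> (\<Sum>i<d. cmod (K $$ (k, i)) * cmod (v i))\<^sup>2"
        by (intro power_mono) auto
      also have "\<dots> \<le> (\<Sum>i<d. (cmod (K $$ (k, i)))\<^sup>2) * (\<Sum>i<d. (cmod (v i))\<^sup>2)"
        by (rule Cauchy_Schwarz_ineq_sum)
      finally show "(cmod (\<Sum>i<d. K $$ (k, i) * v i))\<^sup>2
        \<le> (\<Sum>i<d. (cmod (K $$ (k, i)))\<^sup>2) * (\<Sum>i<d. (cmod (v i))\<^sup>2)" .
    qed
    also have "\<dots> = (\<Sum>i<d. (cmod (v i))\<^sup>2)"
      unfolding sum_distrib_right[symmetric] tr by simp
    finally have "0 \<le> quad_form d (1\<^sub>m d) v + - 1 * quad_form d \<sigma> v"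
      unfolding one gram by (simp add: less_eq_complex_def)
    also have "\<dots> = quad_form d (1\<^sub>m d + (- 1) \<cdot>\<^sub>m \<sigma>) v"
      using psd_carrier[OF \<sigma>(1)] by (simp add: quad_form_add quad_form_smult)
    also have "1\<^sub>m d + (- 1) \<cdot>\<^sub>m \<sigma> = 1\<^sub>m d - \<sigma>"
      using psd_carrier[OF \<sigma>(1)] by (intro eq_matI) auto
    finally show ?thesis .
  qed
  moreover have "mat_adjoint (1\<^sub>m d - \<sigma>) = 1\<^sub>m d - \<sigma>"
    using psd_carrier[OF \<sigma>(1)] psd_hermitian_index[OF \<sigma>(1)] by (intro eq_matI) auto
  ultimately show ?thesis using psd_carrier[OF \<sigma>(1)] by (auto simp: psd_iff)
qed

section \<open>Sums and tensor products of matrices\<close>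

lemma sum_mats_Nil [simp]: "sum_mats d [] = 0\<^sub>m d d"
  by (simp add: sum_mats_def)

lemma sum_mats_Cons [simp]: "sum_mats d (A # As) = A + sum_mats d As"
  by (simp add: sum_mats_def)

lemma sum_mats_carrier [simp]: "set As \<subseteq> carrier_mat d d \<Longrightarrow> sum_mats d As \<in> carrier_mat d d"
  by (induction As) auto

lemma sum_mats_append:
  assumes "set As \<subseteq> carrier_mat d d" "set Bs \<subseteq> carrier_mat d d"
  shows "sum_mats d (As @ Bs) = sum_mats d As + sum_mats d Bs"
  using assms by (induction As) (auto simp: assoc_add_mat[of _ d d])

lemma mult_sum_mats_mult:
  assumes X: "X \<in> carrier_mat e d" and Y: "Y \<in> carrier_mat d e" and "set As \<subseteq> carrier_mat d d"
  shows "X * sum_mats d As * Y = sum_mats e (map (\<lambda>A. X * A * Y) As)"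
  using assms(3)
proof (induction As)
  case Nil
  then show ?case using X Y by simp
next
  case (Cons A As)
  then have A: "A \<in> carrier_mat d d" and S: "sum_mats d As \<in> carrier_mat d d" by auto
  have "X * (A + sum_mats d As) * Y = X * A * Y + X * sum_mats d As * Y"
    using X Y A S by (simp add: mult_add_distrib_mat[OF X A S]
        add_mult_distrib_mat[of "X * A" e d "X * sum_mats d As" Y e])
  with Cons show ?case by simp
qed

lemma mtrace_add:
  assumes "A \<in> carrier_mat d d" "B \<in> carrier_mat d d"
  shows "mtrace (A + B) = mtrace A + mtrace B"
  using assms by (auto simp: mtrace_def sum.distrib)

lemma mtrace_sum_mats:
  assumes "set As \<subseteq> carrier_mat d d"
  shows "mtrace (sum_mats d As) = (\<Sum>A\<leftarrow>As. mtrace A)"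
  using assms
proof (induction As)
  case (Cons A As)
  then show ?case by (simp add: mtrace_add[of _ d])
qed (simp add: mtrace_def)

lemma mtrace_mult_sum_mats:
  assumes "\<rho> \<in> carrier_mat d d" "set As \<subseteq> carrier_mat d d"
  shows "mtrace (\<rho> * sum_mats d As) = (\<Sum>A\<leftarrow>As. mtrace (\<rho> * A))"
  using assms(2)
proof (induction As)
  case Nil
  show ?case using assms(1) by (simp add: mtrace_def)
next
  case (Cons A As)
  then show ?case using assms(1)
    by (simp add: mult_add_distrib_mat[of _ d d _ d] mtrace_add[of _ d])
qed

lemma smult_sum_mats:
  assumes "set As \<subseteq> carrier_mat d d"
  shows "c \<cdot>\<^sub>m sum_mats d As = sum_mats d (map (\<lambda>A. c \<cdot>\<^sub>m A) As)"
  using assms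
proof (induction As)
  case Nil
  show ?case by simp
next
  case (Cons A As)
  then show ?case
    by (simp add: add_smult_distrib_left_mat[of _ d d])
qed

lemma psd_sum_mats: "(\<And>A. A \<in> set As \<Longrightarrow> psd d A) \<Longrightarrow> psd d (sum_mats d As)"
  by (induction As) (auto intro: psd_add)

text \<open>Division with remainder is the bijection between the lexicographic index and the pair of
  local indices; it splits every sum over a Kronecker product.\<close>

lemma sum_div_mod:
  fixes f :: "nat \<Rightarrow> nat \<Rightarrow> 'a :: comm_monoid_add"
  shows "(\<Sum>k<m * n. f (k div n) (k mod n)) = (\<Sum>p<m. \<Sum>q<n. f p q)"
proof -
  have "(\<Sum>k<m * n. f (k div n) (k mod n)) = (\<Sum>(p, q)\<in>{..<m} \<times> {..<n}. f p q)"
  proof (rule sum.reindex_bij_witness[where i = "\<lambda>(p, q). p * n + q" and j = "\<lambda>k. (k div n, k mod n)"], goal_cases)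
    case (2 k)
    then have "0 < n" by (cases n) auto
    with 2 show ?case by (auto simp: less_mult_imp_div_less)
  next
    case (4 pq)
    then obtain p q where pq: "pq = (p, q)" "p < m" "q < n" by auto
    then have "p * n + q < Suc p * n" by simp
    also have "\<dots> \<le> m * n" using pq by (intro mult_le_mono1) simp
    finally show ?case using pq by simp
  qed auto
  then show ?thesis by (simp add: sum.cartesian_product)
qed

section \<open>Kronecker products of two matrices\<close>

lemma dim_kron [simp]:
  "dim_row (kron A B) = dim_row A * dim_row B" "dim_col (kron A B) = dim_col A * dim_col B"
  by (simp_all add: kron_def)

lemma index_kron [simp]:
  "i < dim_row A * dim_row B \<Longrightarrow> j < dim_col A * dim_col B \<Longrightarrow> kron A B $$ (i, j)
    = A $$ (i div dim_row B, j div dim_col B) * B $$ (i mod dim_row B, j mod dim_col B)"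
  by (simp add: kron_def)

lemma kron_carrier: "A \<in> carrier_mat a b \<Longrightarrow> B \<in> carrier_mat c d \<Longrightarrow> kron A B \<in> carrier_mat (a * c) (b * d)"
  by (auto simp: kron_def)

lemma mod_less_of_less_mult: "(i :: nat) < m * n \<Longrightarrow> i mod n < n"
  by (cases n) auto

text \<open>The mixed-product rule: the sum over the composite index becomes a double sum, and its
  summand separates.\<close>

lemma kron_mult:
  assumes "dim_col A = dim_row C" "dim_col B = dim_row D"
  shows "kron A B * kron C D = kron (A * C) (B * D)"
proof (rule eq_matI, goal_cases)
  case (1 i j)
  then have ij: "i < dim_row A * dim_row B" "j < dim_col C * dim_col D" by auto
  note div_mod = ij[THEN less_mult_imp_div_less] ij[THEN mod_less_of_less_mult]
  let ?f = "\<lambda>p q. A $$ (i div dim_row B, p) * B $$ (i mod dim_row B, q)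
    * (C $$ (p, j div dim_col D) * D $$ (q, j mod dim_col D))"
  have "(kron A B * kron C D) $$ (i, j)
      = (\<Sum>k<dim_row C * dim_row D. kron A B $$ (i, k) * kron C D $$ (k, j))"
    using ij assms by (intro index_mult_mat_sum) auto
  also have "\<dots> = (\<Sum>k<dim_row C * dim_row D. ?f (k div dim_row D) (k mod dim_row D))"
    using ij assms by (intro sum.cong) auto
  also have "\<dots> = (\<Sum>p<dim_row C. \<Sum>q<dim_row D. ?f p q)"
    by (rule sum_div_mod)
  also have "\<dots> = (A * C) $$ (i div dim_row B, j div dim_col D) * (B * D) $$ (i mod dim_row B, j mod dim_col D)"
    using div_mod assms
    by (subst (1 2) index_mult_mat_sum[OF carrier_matI carrier_matI])
      (auto simp: sum_product mult_ac)
  also have "\<dots> = kron (A * C) (B * D) $$ (i, j)"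
    using ij by simp
  finally show ?case .
qed auto

lemma kron_adjoint: "mat_adjoint (kron A B) = kron (mat_adjoint A) (mat_adjoint B)"
proof (rule eq_matI, goal_cases)
  case (1 i j)
  then have ij: "i < dim_col A * dim_col B" "j < dim_row A * dim_row B" by auto
  note div_mod = ij[THEN less_mult_imp_div_less] ij[THEN mod_less_of_less_mult]
  show ?case using ij div_mod by simp
qed auto

lemma kron_one: "kron (1\<^sub>m a) (1\<^sub>m b) = 1\<^sub>m (a * b)"
proof (rule eq_matI, goal_cases)
  case (1 i j)
  then have ij: "i < a * b" "j < a * b" by auto
  note div_mod = ij[THEN less_mult_imp_div_less] ij[THEN mod_less_of_less_mult]
  have "i = j \<longleftrightarrow> i div b = j div b \<and> i mod b = j mod b"
    by (metis div_mult_mod_eq)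
  then show ?case using ij div_mod by auto
qed auto

lemma mtrace_kron:
  assumes "A \<in> carrier_mat a a" "B \<in> carrier_mat b b"
  shows "mtrace (kron A B) = mtrace A * mtrace B"
proof -
  have "mtrace (kron A B) = (\<Sum>i<a * b. A $$ (i div b, i div b) * B $$ (i mod b, i mod b))"
    using assms unfolding mtrace_def by (intro sum.cong) auto
  also have "\<dots> = mtrace A * mtrace B"
    unfolding sum_div_mod[of "\<lambda>p q. A $$ (p, p) * B $$ (q, q)"] mtrace_def sum_product
    using assms by simp
  finally show ?thesis .
qed

lemma kron_smult:
  "kron (c \<cdot>\<^sub>m A) (e \<cdot>\<^sub>m B) = (c * e) \<cdot>\<^sub>m kron A B"
proof (rule eq_matI, goal_cases)
  case (1 i j)
  then have ij: "i < dim_row A * dim_row B" "j < dim_col A * dim_col B" by auto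
  note div_mod = ij[THEN less_mult_imp_div_less] ij[THEN mod_less_of_less_mult]
  show ?case using ij div_mod by simp
qed auto

lemma kron_add_left:
  assumes "dim_row A = dim_row B" "dim_col A = dim_col B"
  shows "kron (A + B) C = kron A C + kron B C"
proof (rule eq_matI, goal_cases)
  case (1 i j)
  then have ij: "i < dim_row B * dim_row C" "j < dim_col B * dim_col C" using assms by auto
  note div_mod = ij[THEN less_mult_imp_div_less] ij[THEN mod_less_of_less_mult]
  show ?case using ij div_mod assms by (simp add: algebra_simps)
qed (use assms in auto)

lemma kron_add_right:
  assumes "dim_row A = dim_row B" "dim_col A = dim_col B"
  shows "kron C (A + B) = kron C A + kron C B"
proof (rule eq_matI, goal_cases)
  case (1 i j)
  then have ij: "i < dim_row C * dim_row B" "j < dim_col C * dim_col B" using assms by auto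
  note div_mod = ij[THEN less_mult_imp_div_less] ij[THEN mod_less_of_less_mult]
  show ?case using ij div_mod assms by (simp add: algebra_simps)
qed (use assms in auto)

lemma kron_zero_left: "kron (0\<^sub>m a b) C = 0\<^sub>m (a * dim_row C) (b * dim_col C)"
proof (rule eq_matI, goal_cases)
  case (1 i j)
  then have ij: "i < a * dim_row C" "j < b * dim_col C" by auto
  note div_mod = ij[THEN less_mult_imp_div_less] ij[THEN mod_less_of_less_mult]
  show ?case using ij div_mod by simp
qed auto

lemma kron_zero_right: "kron C (0\<^sub>m a b) = 0\<^sub>m (dim_row C * a) (dim_col C * b)"
proof (rule eq_matI, goal_cases)
  case (1 i j)
  then have ij: "i < dim_row C * a" "j < dim_col C * b" by auto
  note div_mod = ij[THEN less_mult_imp_div_less] ij[THEN mod_less_of_less_mult]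
  show ?case using ij div_mod by simp
qed auto

text \<open>By the mixed-product rule, the Kronecker product of the factors is a factor of the
  Kronecker product.\<close>

lemma psd_kron:
  assumes "psd a A" "psd b B"
  shows "psd (a * b) (kron A B)"
proof -
  obtain K where K: "K \<in> carrier_mat a a" "A = mat_adjoint K * K"
    using psd_factor[OF assms(1)] .
  obtain L where L: "L \<in> carrier_mat b b" "B = mat_adjoint L * L"
    using psd_factor[OF assms(2)] .
  have "kron A B = mat_adjoint (kron K L) * kron K L"
    by (simp add: K(2) L(2) kron_adjoint kron_mult)
  with psd_gram[OF kron_carrier[OF K(1) L(1)]] show ?thesis by simp
qed

section \<open>Tensor products of lists of matrices\<close>

lemma tensor_Nil [simp]: "tensor [] = 1\<^sub>m 1"
  by (simp add: tensor_def)

lemma tensor_Cons [simp]: "tensor (A # As) = kron A (tensor As)"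
  by (simp add: tensor_def)

lemma dim_tensor [simp]:
  "dim_row (tensor As) = prod_list (map dim_row As)"
  "dim_col (tensor As) = prod_list (map dim_col As)"
  by (induction As) auto

lemma tensor_mult:
  assumes "list_all2 (\<lambda>A B. dim_col A = dim_row B) As Bs"
  shows "tensor As * tensor Bs = tensor (map2 (*) As Bs)"
  using assms
proof (induction rule: list_all2_induct)
  case (Cons A As B Bs)
  have "map dim_col As = map dim_row Bs"
    using Cons(2) by (induction rule: list_all2_induct) auto
  with Cons show ?case by (simp add: kron_mult)
qed simp

lemma tensor_adjoint: "mat_adjoint (tensor As) = tensor (map mat_adjoint As)"
  by (induction As) (auto simp: kron_adjoint)

lemma tensor_one: "tensor (map (\<lambda>d. 1\<^sub>m d) ds) = 1\<^sub>m (prod_list ds)"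
  by (induction ds) (auto simp: kron_one)

lemma tensor_update_add:
  assumes "k < length As" "dim_row B = dim_row C" "dim_col B = dim_col C"
  shows "tensor (As[k := B + C]) = tensor (As[k := B]) + tensor (As[k := C])"
  using assms(1)
proof (induction As arbitrary: k)
  case (Cons A As)
  show ?case
  proof (cases k)
    case 0
    then show ?thesis using assms by (simp add: kron_add_left)
  next
    case (Suc l)
    with Cons have "tensor (As[l := B + C]) = tensor (As[l := B]) + tensor (As[l := C])" by simp
    with Suc assms(2,3) show ?thesis by (simp add: kron_add_right map_update)
  qed
qed simp

lemma tensor_update_zero:
  assumes "k < length As"
  shows "tensor (As[k := 0\<^sub>m a b])
    = 0\<^sub>m (prod_list ((map dim_row As)[k := a])) (prod_list ((map dim_col As)[k := b]))"
  using assms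
proof (induction As arbitrary: k)
  case (Cons A As)
  then show ?case by (cases k) (auto simp: kron_zero_left kron_zero_right)
qed simp

lemma psd_tensor: "list_all2 psd ds As \<Longrightarrow> psd (prod_list ds) (tensor As)"
  by (induction rule: list_all2_induct) (auto intro: psd_kron)

lemma state_tensor: "list_all2 state ds \<sigma>s \<Longrightarrow> state (prod_list ds) (tensor \<sigma>s)"
proof (induction rule: list_all2_induct)
  case Nil
  show ?case by (simp add: state_def mtrace_def)
next
  case (Cons d ds \<sigma> \<sigma>s)
  then show ?case
    by (auto simp: state_def psd_kron mtrace_kron[OF psd_carrier psd_carrier])
qed

text \<open>Pulling a product state back through a Kraus operator leaves factors that are positive
  but not normalised. Multilinearity collects the normalisation constants in one weight, which
  brings the term back to the form that \<open>SEP\<close> demands.\<close>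

lemma tensor_normalize:
  assumes "list_all2 psd ds As" "\<forall>d \<in> set ds. 0 < d"
  shows "\<exists>p \<sigma>s. 0 \<le> p \<and> list_all2 state ds \<sigma>s \<and> tensor As = complex_of_real p \<cdot>\<^sub>m tensor \<sigma>s"
  using assms
proof (induction rule: list_all2_induct)
  case Nil
  have "1\<^sub>m 1 = complex_of_real 1 \<cdot>\<^sub>m 1\<^sub>m 1" by (intro eq_matI) auto
  then show ?case by (intro exI[of _ 1] exI[of _ "[]"]) auto
next
  case (Cons d ds A As)
  then obtain q \<sigma>s where q: "0 \<le> q" "list_all2 state ds \<sigma>s"
    "tensor As = complex_of_real q \<cdot>\<^sub>m tensor \<sigma>s" by auto
  obtain p \<sigma> where p: "0 \<le> p" "state d \<sigma>" "A = complex_of_real p \<cdot>\<^sub>m \<sigma>"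
    using psd_normalize[of d A] Cons by auto
  show ?case
    using p q by (intro exI[of _ "p * q"] exI[of _ "\<sigma> # \<sigma>s"]) (auto simp: kron_smult)
qed

section \<open>Operators acting on one tensor factor\<close>

lemma extend_op_carrier:
  assumes "k < length ds" "K \<in> carrier_mat d' (ds ! k)"
  shows "extend_op ds k K \<in> carrier_mat (prod_list (ds[k := d'])) (prod_list ds)"
proof -
  have "map dim_row ((map (\<lambda>d. 1\<^sub>m d) ds)[k := K]) = ds[k := d']"
    "map dim_col ((map (\<lambda>d. 1\<^sub>m d) ds)[k := K]) = ds"
    using assms by (auto intro!: nth_equalityI simp: nth_list_update)
  then show ?thesis unfolding extend_op_def by (intro carrier_matI) (simp_all only: dim_tensor)
qed

text \<open>The other slots of the extended operator are identities, so only slot \<open>k\<close>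
  changes. The product lives on the dimensions after the operation and its pull-back on those before
  it.\<close>

lemma tensor_congruence:
  assumes "k < length ds" "K \<in> carrier_mat d' (ds ! k)"
    and As: "list_all2 (\<lambda>d A. A \<in> carrier_mat d d) (ds[k := d']) As"
  shows "mat_adjoint (extend_op ds k K) * tensor As * extend_op ds k K
    = tensor (As[k := mat_adjoint K * As ! k * K])"
proof -
  let ?Xs = "(map (\<lambda>d. 1\<^sub>m d) ds)[k := K] :: complex mat list"
  have len: "length As = length ds" using As by (auto dest: list_all2_lengthD)
  have nth: "As ! i \<in> carrier_mat (ds[k := d'] ! i) (ds[k := d'] ! i)" if "i < length ds" for i
    using As that by (auto simp: list_all2_conv_all_nth)
  have 1: "tensor (map mat_adjoint ?Xs) * tensor As = tensor (map2 (*) (map mat_adjoint ?Xs) As)"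
    using assms len nth
    by (intro tensor_mult) (auto simp: list_all2_conv_all_nth nth_list_update split: if_splits)
  have 2: "tensor (map2 (*) (map mat_adjoint ?Xs) As) * tensor ?Xs
      = tensor (map2 (*) (map2 (*) (map mat_adjoint ?Xs) As) ?Xs)"
    using assms len nth
    by (intro tensor_mult) (auto simp: list_all2_conv_all_nth nth_list_update split: if_splits)
  have 3: "map2 (*) (map2 (*) (map mat_adjoint ?Xs) As) ?Xs = As[k := mat_adjoint K * As ! k * K]"
  proof (rule nth_equalityI, goal_cases)
    case (2 i)
    then have i: "i < length ds" using len by simp
    then show ?case using assms(1) len nth[OF i]
      by (cases "i = k") (auto simp: nth_list_update)
  qed (use len in simp)
  show ?thesis unfolding extend_op_def tensor_adjoint 1 2 3 ..
qed

lemma extend_op_sum_mats: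
  assumes "k < length ds" "set Bs \<subseteq> carrier_mat (ds ! k) (ds ! k)"
  shows "extend_op ds k (sum_mats (ds ! k) Bs) = sum_mats (prod_list ds) (map (extend_op ds k) Bs)"
  using assms(2)
proof (induction Bs)
  case Nil
  have "(map dim_row (map (\<lambda>d. 1\<^sub>m d :: complex mat) ds))[k := ds ! k] = ds"
    "(map dim_col (map (\<lambda>d. 1\<^sub>m d :: complex mat) ds))[k := ds ! k] = ds"
    using assms(1) by (auto intro!: nth_equalityI simp: nth_list_update)
  then show ?case using assms(1)
    by (simp add: extend_op_def tensor_update_zero del: map_map)
next
  case (Cons B Bs)
  then have "B \<in> carrier_mat (ds ! k) (ds ! k)" "sum_mats (ds ! k) Bs \<in> carrier_mat (ds ! k) (ds ! k)"
    by auto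
  then have "extend_op ds k (B + sum_mats (ds ! k) Bs)
      = extend_op ds k B + extend_op ds k (sum_mats (ds ! k) Bs)"
    unfolding extend_op_def using assms(1) by (intro tensor_update_add) (auto dest!: carrier_matD)
  with Cons show ?case by simp
qed

text \<open>An instance of \<open>tensor_congruence\<close> with identity factors on the dimensions
  after the operation. It lifts the local completeness relation to the whole space.\<close>

lemma extend_op_gram:
  assumes "k < length ds" "K \<in> carrier_mat d' (ds ! k)"
  shows "mat_adjoint (extend_op ds k K) * extend_op ds k K = extend_op ds k (mat_adjoint K * K)"
proof -
  let ?X = "extend_op ds k K"
  have "mat_adjoint ?X * ?X = mat_adjoint ?X * tensor (map (\<lambda>d. 1\<^sub>m d) (ds[k := d'])) * ?X"
    using extend_op_carrier[OF assms] unfolding tensor_one by simp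
  also have "\<dots> = tensor ((map (\<lambda>d. 1\<^sub>m d) (ds[k := d']))[k := mat_adjoint K * 1\<^sub>m d' * K])"
    using assms by (subst tensor_congruence[OF assms]) (auto simp: list_all2_conv_all_nth)
  also have "mat_adjoint K * 1\<^sub>m d' * K = mat_adjoint K * K"
    using assms by (metis mat_adjoint_carrier right_mult_one_mat)
  finally show ?thesis by (simp add: extend_op_def map_update)
qed

section \<open>Separable operators\<close>

lemma smult_mult_dim:
  "dim_col A = dim_row B \<Longrightarrow> (c \<cdot>\<^sub>m A) * B = c \<cdot>\<^sub>m (A * (B :: complex mat))"
  by (rule mult_smult_assoc_mat[of _ "dim_row A" "dim_col A" _ "dim_col B"]) auto

lemma mult_smult_dim:
  "dim_col A = dim_row B \<Longrightarrow> A * (c \<cdot>\<^sub>m B) = c \<cdot>\<^sub>m (A * (B :: complex mat))"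
  by (rule mult_smult_distrib[of _ "dim_row A" "dim_col A" _ "dim_col B"]) auto

lemma mtrace_mult_smult:
  assumes "A \<in> carrier_mat d d" "B \<in> carrier_mat d d"
  shows "mtrace (A * (c \<cdot>\<^sub>m B)) = c * mtrace (A * B)"
  using assms by (simp add: mult_smult_distrib[of A d d B d] mtrace_smult[of _ d])

lemma smult_smult_mat: "a \<cdot>\<^sub>m (b \<cdot>\<^sub>m A) = (a * b :: complex) \<cdot>\<^sub>m A"
  by (intro eq_matI) auto

lemma tensor_psd_carrier:
  "list_all2 psd ds As \<Longrightarrow> tensor As \<in> carrier_mat (prod_list ds) (prod_list ds)"
  by (intro psd_carrier psd_tensor)

lemma state_carrier: "state d \<rho> \<Longrightarrow> \<rho> \<in> carrier_mat d d"
  by (simp add: state_def psd_carrier)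

lemma SEP_psd: "E \<in> SEP ds \<Longrightarrow> psd (prod_list ds) E"
  by (simp add: SEP_def)

lemma SEP_carrier: "E \<in> SEP ds \<Longrightarrow> E \<in> carrier_mat (prod_list ds) (prod_list ds)"
  by (intro psd_carrier SEP_psd)

lemma SEP_decompose:
  assumes "E \<in> SEP ds"
  obtains ts where "\<And>p \<sigma>s. (p, \<sigma>s) \<in> set ts \<Longrightarrow> 0 \<le> p \<and> list_all2 state ds \<sigma>s"
    "E = sum_mats (prod_list ds) (map (\<lambda>(p, \<sigma>s). complex_of_real p \<cdot>\<^sub>m tensor \<sigma>s) ts)"
  using assms unfolding SEP_def by blast

lemma list_all2_state_psd: "list_all2 state ds \<sigma>s \<Longrightarrow> list_all2 psd ds \<sigma>s"
  by (erule list_all2_mono) (auto simp: state_def)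

text \<open>Membership test for terms with merely positive factors: each term is normalised
  separately, and the constant is absorbed in its weight.\<close>

lemma SEP_sum_tensorsI:
  assumes pos: "\<forall>d \<in> set ds. 0 < d"
    and ts: "\<And>p As. (p, As) \<in> set ts \<Longrightarrow> 0 \<le> p \<and> list_all2 psd ds As"
  shows "sum_mats (prod_list ds) (map (\<lambda>(p, As). complex_of_real p \<cdot>\<^sub>m tensor As) ts) \<in> SEP ds"
    (is "?E \<in> _")
proof -
  have "\<forall>t \<in> set ts. \<exists>q \<sigma>s. 0 \<le> q \<and> list_all2 state ds \<sigma>s
    \<and> complex_of_real (fst t) \<cdot>\<^sub>m tensor (snd t) = complex_of_real q \<cdot>\<^sub>m tensor \<sigma>s"
  proof
    fix t assume t: "t \<in> set ts"
    then have pt: "0 \<le> fst t" "list_all2 psd ds (snd t)" using ts[of "fst t" "snd t"] by auto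
    obtain q \<sigma>s where "0 \<le> q" "list_all2 state ds \<sigma>s"
      "tensor (snd t) = complex_of_real q \<cdot>\<^sub>m tensor \<sigma>s"
      using tensor_normalize[OF pt(2) pos] by blast
    then show "\<exists>q \<sigma>s. 0 \<le> q \<and> list_all2 state ds \<sigma>s
      \<and> complex_of_real (fst t) \<cdot>\<^sub>m tensor (snd t) = complex_of_real q \<cdot>\<^sub>m tensor \<sigma>s"
      using pt by (intro exI[of _ "fst t * q"] exI[of _ \<sigma>s]) (auto simp: smult_smult_mat)
  qed
  then obtain q \<sigma> where q\<sigma>: "\<And>t. t \<in> set ts \<Longrightarrow> 0 \<le> q t \<and> list_all2 state ds (\<sigma> t)
    \<and> complex_of_real (fst t) \<cdot>\<^sub>m tensor (snd t) = complex_of_real (q t) \<cdot>\<^sub>m tensor (\<sigma> t)"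
    by metis
  have "psd (prod_list ds) ?E"
    using ts by (intro psd_sum_mats) (auto intro!: psd_smult psd_tensor)
  moreover have "?E = sum_mats (prod_list ds)
      (map (\<lambda>(p, \<sigma>s). complex_of_real p \<cdot>\<^sub>m tensor \<sigma>s) (map (\<lambda>t. (q t, \<sigma> t)) ts))"
    using q\<sigma> by (intro arg_cong[of _ _ "sum_mats _"]) (auto simp: case_prod_unfold)
  moreover have "\<forall>(p, \<sigma>s) \<in> set (map (\<lambda>t. (q t, \<sigma> t)) ts). 0 \<le> p \<and> list_all2 state ds \<sigma>s"
    using q\<sigma> by auto
  ultimately show ?thesis unfolding SEP_def by blast
qed

lemma SEP_zero: "0\<^sub>m (prod_list ds) (prod_list ds) \<in> SEP ds"
  unfolding SEP_def by (auto intro!: exI[of _ "[]"])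

lemma SEP_add:
  assumes "E \<in> SEP ds" "F \<in> SEP ds"
  shows "E + F \<in> SEP ds"
proof -
  let ?g = "\<lambda>(p, \<sigma>s). complex_of_real p \<cdot>\<^sub>m tensor \<sigma>s"
  obtain ts where ts: "\<And>p \<sigma>s. (p, \<sigma>s) \<in> set ts \<Longrightarrow> 0 \<le> p \<and> list_all2 state ds \<sigma>s"
    "E = sum_mats (prod_list ds) (map ?g ts)"
    using SEP_decompose[OF assms(1)] by blast
  obtain us where us: "\<And>p \<sigma>s. (p, \<sigma>s) \<in> set us \<Longrightarrow> 0 \<le> p \<and> list_all2 state ds \<sigma>s"
    "F = sum_mats (prod_list ds) (map ?g us)"
    using SEP_decompose[OF assms(2)] by blast
  have carr: "set (map ?g xs) \<subseteq> carrier_mat (prod_list ds) (prod_list ds)"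
    if "\<And>p \<sigma>s. (p, \<sigma>s) \<in> set xs \<Longrightarrow> 0 \<le> p \<and> list_all2 state ds \<sigma>s" for xs
    using that by (auto intro!: smult_carrier_mat tensor_psd_carrier list_all2_state_psd)
  have "E + F = sum_mats (prod_list ds) (map ?g (ts @ us))"
    unfolding ts(2) us(2) map_append
    by (rule sum_mats_append[symmetric]) (use carr ts(1) us(1) in blast)+
  moreover have "\<forall>(p, \<sigma>s) \<in> set (ts @ us). 0 \<le> p \<and> list_all2 state ds \<sigma>s"
    using ts(1) us(1) by auto
  ultimately show ?thesis
    unfolding SEP_def using psd_add[OF assms[THEN SEP_psd]] by blast
qed

lemma SEP_sum_mats: "set Es \<subseteq> SEP ds \<Longrightarrow> sum_mats (prod_list ds) Es \<in> SEP ds"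
  by (induction Es) (auto intro: SEP_zero SEP_add)

lemma SEP_one:
  assumes "\<forall>d \<in> set ds. 0 < d"
  shows "1\<^sub>m (prod_list ds) \<in> SEP ds"
proof -
  have "sum_mats (prod_list ds) (map (\<lambda>(p, As). complex_of_real p \<cdot>\<^sub>m tensor As)
      [(1, map (\<lambda>d. 1\<^sub>m d) ds)]) \<in> SEP ds"
    using assms by (intro SEP_sum_tensorsI) (auto simp: list_all2_conv_all_nth)
  moreover have "1 \<cdot>\<^sub>m 1\<^sub>m (prod_list ds) = (1\<^sub>m (prod_list ds) :: complex mat)"
    by (intro eq_matI) auto
  ultimately show ?thesis by (simp add: tensor_one)
qed

lemma SEP_smult:
  assumes "E \<in> SEP ds" "0 \<le> r" and pos: "\<forall>d \<in> set ds. 0 < d"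
  shows "complex_of_real r \<cdot>\<^sub>m E \<in> SEP ds"
proof -
  let ?g = "\<lambda>(p, \<sigma>s). complex_of_real p \<cdot>\<^sub>m tensor \<sigma>s"
  obtain ts where ts: "\<And>p \<sigma>s. (p, \<sigma>s) \<in> set ts \<Longrightarrow> 0 \<le> p \<and> list_all2 state ds \<sigma>s"
    "E = sum_mats (prod_list ds) (map ?g ts)"
    using SEP_decompose[OF assms(1)] by blast
  have "set (map ?g ts) \<subseteq> carrier_mat (prod_list ds) (prod_list ds)"
    using ts(1) by (auto intro!: smult_carrier_mat tensor_psd_carrier list_all2_state_psd)
  then have "complex_of_real r \<cdot>\<^sub>m E
      = sum_mats (prod_list ds) (map ?g (map (\<lambda>(p, \<sigma>s). (r * p, \<sigma>s)) ts))"
    unfolding ts(2) by (subst smult_sum_mats)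
      (auto simp: case_prod_unfold smult_smult_mat intro!: arg_cong[of _ _ "sum_mats _"])
  also have "\<dots> \<in> SEP ds"
    using ts(1) assms(2) by (intro SEP_sum_tensorsI[OF pos]) (auto intro: list_all2_state_psd)
  finally show ?thesis .
qed

text \<open>In each product term only factor \<open>k\<close> is changed, by a congruence that keeps
  it positive; its trace may change, so the new decomposition goes through
  \<open>SEP_sum_tensorsI\<close>.\<close>

lemma SEP_congruence:
  assumes E: "E \<in> SEP (ds[k := d'])" and pos: "\<forall>d \<in> set ds. 0 < d"
    and k: "k < length ds" and K: "K \<in> carrier_mat d' (ds ! k)"
  shows "mat_adjoint (extend_op ds k K) * E * extend_op ds k K \<in> SEP ds"
proof -
  let ?g = "\<lambda>(p, \<sigma>s). complex_of_real p \<cdot>\<^sub>m tensor \<sigma>s"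
  let ?X = "extend_op ds k K" and ?D = "prod_list ds" and ?D' = "prod_list (ds[k := d'])"
  obtain ts where ts: "\<And>p \<sigma>s. (p, \<sigma>s) \<in> set ts \<Longrightarrow> 0 \<le> p \<and> list_all2 state (ds[k := d']) \<sigma>s"
    "E = sum_mats ?D' (map ?g ts)"
    using SEP_decompose[OF E] by blast
  have X: "?X \<in> carrier_mat ?D' ?D" using extend_op_carrier[OF k K] .
  have psds: "list_all2 psd (ds[k := d']) \<sigma>s" if "(p, \<sigma>s) \<in> set ts" for p \<sigma>s
    using ts(1)[OF that] by (auto intro: list_all2_state_psd)
  have carr: "set (map ?g ts) \<subseteq> carrier_mat ?D' ?D'"
    using psds by (auto intro!: smult_carrier_mat tensor_psd_carrier)
  let ?h = "\<lambda>\<sigma>s. \<sigma>s[k := mat_adjoint K * \<sigma>s ! k * K]"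
  have "mat_adjoint ?X * ?g (p, \<sigma>s) * ?X = ?g (p, ?h \<sigma>s)" if "(p, \<sigma>s) \<in> set ts" for p \<sigma>s
  proof -
    note l = psds[OF that]
    have T: "tensor \<sigma>s \<in> carrier_mat ?D' ?D'" using psd_carrier[OF psd_tensor[OF l]] .
    have "mat_adjoint ?X * ?g (p, \<sigma>s) * ?X = complex_of_real p \<cdot>\<^sub>m (mat_adjoint ?X * tensor \<sigma>s * ?X)"
      using carrier_matD[OF X] carrier_matD[OF T] by (simp add: smult_mult_dim mult_smult_dim)
    also have "mat_adjoint ?X * tensor \<sigma>s * ?X = tensor (?h \<sigma>s)"
      using l by (intro tensor_congruence[OF k K]) (auto elim!: list_all2_mono dest: psd_carrier)
    finally show ?thesis by simp
  qed
  then have "mat_adjoint ?X * E * ?X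
      = sum_mats ?D (map ?g (map (\<lambda>(p, \<sigma>s). (p, ?h \<sigma>s)) ts))"
    unfolding ts(2) using X
    by (subst mult_sum_mats_mult[OF _ X carr]) (auto intro!: arg_cong[of _ _ "sum_mats _"])
  also have "\<dots> \<in> SEP ds"
  proof (rule SEP_sum_tensorsI[OF pos])
    fix p As assume "(p, As) \<in> set (map (\<lambda>(p, \<sigma>s). (p, ?h \<sigma>s)) ts)"
    then obtain \<sigma>s where \<sigma>s: "(p, \<sigma>s) \<in> set ts" "As = ?h \<sigma>s" by auto
    note l = psds[OF \<sigma>s(1)]
    have "psd (ds ! k) (mat_adjoint K * \<sigma>s ! k * K)"
      using list_all2_nthD[OF l, of k] k by (intro psd_congruence[OF _ K]) simp
    then have "list_all2 psd ds As"
      using l k unfolding \<sigma>s(2) list_all2_conv_all_nth by (auto simp: nth_list_update)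
    then show "0 \<le> p \<and> list_all2 psd ds As" using ts(1)[OF \<sigma>s(1)] by simp
  qed
  finally show ?thesis .
qed

section \<open>LOCC measurements are separable\<close>

text \<open>
  The POVM element of outcome \<open>i\<close>, obtained by pulling the identity back from the leaves (Heisenberg
  picture), whereas \<^const>\<open>outcome_prob\<close> pushes states forward.
\<close>

fun effect :: "nat list \<Rightarrow> protocol \<Rightarrow> nat \<Rightarrow> complex mat" where
  "effect ds (Output i') i = (if i = i' then 1\<^sub>m (prod_list ds) else 0\<^sub>m (prod_list ds) (prod_list ds))"
| "effect ds (Local k bs) i = sum_mats (prod_list ds) (concat (map (\<lambda>(d', Ks, P).
     map (\<lambda>K. mat_adjoint (extend_op ds k K) * effect (ds[k := d']) P i * extend_op ds k K) Ks) bs))"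

text \<open>The local dimensions change along the branches, so the dimension list varies together
  with the tree. The recursion through lists of triples is hidden here.\<close>

lemma protocol_induct:
  assumes "\<And>ds i. Q ds (Output i)"
    and "\<And>ds k bs. (\<And>d' Ks P. (d', Ks, P) \<in> set bs \<Longrightarrow> Q (ds[k := d']) P) \<Longrightarrow> Q ds (Local k bs)"
  shows "Q ds P"
proof (induction P arbitrary: ds)
  case (Local k bs)
  show ?case
  proof (rule assms(2))
    fix d' Ks P assume "(d', Ks, P) \<in> set bs"
    then show "Q (ds[k := d']) P" by (rule Local) auto
  qed
qed (rule assms(1))

lemma pos_update: "\<forall>d \<in> set ds. 0 < d \<Longrightarrow> 0 < d' \<Longrightarrow> \<forall>d \<in> set (ds[k := d']). 0 < (d :: nat)"
  using set_update_subset_insert by fastforce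

lemma valid_LocalD:
  assumes "valid_protocol n ds (Local k bs)" "(d', Ks, P) \<in> set bs"
  shows "k < length ds" "0 < d'" "set Ks \<subseteq> carrier_mat d' (ds ! k)" "valid_protocol n (ds[k := d']) P"
  using assms by auto

lemma effect_SEP:
  assumes "valid_protocol n ds P" "\<forall>d \<in> set ds. 0 < d"
  shows "effect ds P i \<in> SEP ds"
  using assms
proof (induction ds P rule: protocol_induct)
  case (1 ds i')
  then show ?case using SEP_one SEP_zero by auto
next
  case (2 ds k bs)
  have "mat_adjoint (extend_op ds k K) * effect (ds[k := d']) P i * extend_op ds k K \<in> SEP ds"
    if b: "(d', Ks, P) \<in> set bs" and K: "K \<in> set Ks" for d' Ks P K
  proof -
    note v = valid_LocalD[OF 2(2) b]
    show ?thesis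
      using 2(1)[OF b v(4) pos_update[OF 2(3) v(2)]] v K by (intro SEP_congruence[OF _ 2(3)]) auto
  qed
  then show ?case by (auto intro!: SEP_sum_mats)
qed

text \<open>Duality of the Schroedinger and Heisenberg pictures for one Kraus operator, by cyclicity
  of the trace.\<close>

lemma mtrace_kraus_dual:
  assumes "X \<in> carrier_mat e d" "\<rho> \<in> carrier_mat d d" "E \<in> carrier_mat e e"
  shows "mtrace (X * \<rho> * mat_adjoint X * E) = mtrace (\<rho> * (mat_adjoint X * E * X))"
proof -
  note dims = carrier_matD[OF assms(1)] carrier_matD[OF assms(2)] carrier_matD[OF assms(3)]
  have "mtrace (X * \<rho> * mat_adjoint X * E) = mtrace (X * (\<rho> * mat_adjoint X * E))"
    using dims by (simp add: mat_mult_assoc_dim)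
  also have "\<dots> = mtrace (\<rho> * mat_adjoint X * E * X)"
    using dims by (intro mtrace_comm[of _ e d]) (auto intro!: carrier_matI)
  also have "\<dots> = mtrace (\<rho> * (mat_adjoint X * E * X))"
    using dims by (simp add: mat_mult_assoc_dim)
  finally show ?thesis .
qed

lemma kraus_carrier:
  assumes "k < length ds" "set Ks \<subseteq> carrier_mat d' (ds ! k)" "\<rho> \<in> carrier_mat (prod_list ds) (prod_list ds)"
  shows "set (map (\<lambda>K. extend_op ds k K * \<rho> * mat_adjoint (extend_op ds k K)) Ks)
    \<subseteq> carrier_mat (prod_list (ds[k := d'])) (prod_list (ds[k := d']))"
proof -
  have "extend_op ds k K * \<rho> * mat_adjoint (extend_op ds k K)
      \<in> carrier_mat (prod_list (ds[k := d'])) (prod_list (ds[k := d']))" if "K \<in> set Ks" for K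
  proof -
    have "extend_op ds k K \<in> carrier_mat (prod_list (ds[k := d'])) (prod_list ds)"
      using that assms by (intro extend_op_carrier) auto
    then show ?thesis using assms(3) by (meson mat_adjoint_carrier mult_carrier_mat)
  qed
  then show ?thesis by auto
qed

lemma apply_kraus_carrier:
  assumes "k < length ds" "set Ks \<subseteq> carrier_mat d' (ds ! k)" "\<rho> \<in> carrier_mat (prod_list ds) (prod_list ds)"
  shows "apply_kraus ds k d' Ks \<rho> \<in> carrier_mat (prod_list (ds[k := d'])) (prod_list (ds[k := d']))"
  unfolding apply_kraus_def by (intro sum_mats_carrier kraus_carrier assms)

lemma mtrace_apply_kraus:
  assumes "k < length ds" "set Ks \<subseteq> carrier_mat d' (ds ! k)" "\<rho> \<in> carrier_mat (prod_list ds) (prod_list ds)"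
    and E: "E \<in> carrier_mat (prod_list (ds[k := d'])) (prod_list (ds[k := d']))"
  shows "mtrace (apply_kraus ds k d' Ks \<rho> * E)
    = (\<Sum>K\<leftarrow>Ks. mtrace (\<rho> * (mat_adjoint (extend_op ds k K) * E * extend_op ds k K)))"
proof -
  let ?D' = "prod_list (ds[k := d'])"
  note carr = kraus_carrier[OF assms(1-3)]
  have "mtrace (apply_kraus ds k d' Ks \<rho> * E) = mtrace (E * apply_kraus ds k d' Ks \<rho>)"
    by (rule mtrace_comm[OF apply_kraus_carrier[OF assms(1-3)] E])
  also have "\<dots> = (\<Sum>A\<leftarrow>map (\<lambda>K. extend_op ds k K * \<rho> * mat_adjoint (extend_op ds k K)) Ks. mtrace (E * A))"
    unfolding apply_kraus_def by (rule mtrace_mult_sum_mats[OF E carr])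
  also have "\<dots> = (\<Sum>K\<leftarrow>Ks. mtrace (\<rho> * (mat_adjoint (extend_op ds k K) * E * extend_op ds k K)))"
    unfolding map_map comp_def
  proof (intro arg_cong[of _ _ sum_list] map_cong refl)
    fix K assume K: "K \<in> set Ks"
    have "mtrace (E * (extend_op ds k K * \<rho> * mat_adjoint (extend_op ds k K)))
      = mtrace (extend_op ds k K * \<rho> * mat_adjoint (extend_op ds k K) * E)"
      using carr K by (intro mtrace_comm[OF E]) auto
    also have "\<dots> = mtrace (\<rho> * (mat_adjoint (extend_op ds k K) * E * extend_op ds k K))"
      using assms K by (intro mtrace_kraus_dual[OF extend_op_carrier]) auto
    finally show "mtrace (E * (extend_op ds k K * \<rho> * mat_adjoint (extend_op ds k K)))
      = mtrace (\<rho> * (mat_adjoint (extend_op ds k K) * E * extend_op ds k K))" .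
  qed
  finally show ?thesis .
qed

lemma sum_list_concat_map:
  fixes f :: "'a \<Rightarrow> 'b :: comm_monoid_add"
  shows "(\<Sum>x\<leftarrow>concat xss. f x) = (\<Sum>xs\<leftarrow>xss. \<Sum>x\<leftarrow>xs. f x)"
  by (induction xss) auto

text \<open>Trace duality is applied at each node. The operator \<rho> is arbitrary in the induction
  because a branch receives an unnormalised post-measurement operator.\<close>

lemma outcome_prob_effect:
  assumes "valid_protocol n ds P" "\<forall>d \<in> set ds. 0 < d" "\<rho> \<in> carrier_mat (prod_list ds) (prod_list ds)"
  shows "outcome_prob ds P \<rho> i = mtrace (\<rho> * effect ds P i)"
  using assms
proof (induction ds P arbitrary: \<rho> rule: protocol_induct)
  case (1 ds i')
  then show ?case by (simp add: mtrace_def)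
next
  case (2 ds k bs)
  let ?D = "prod_list ds"
  let ?F = "\<lambda>(d', Ks, P). map (\<lambda>K. mat_adjoint (extend_op ds k K) * effect (ds[k := d']) P i * extend_op ds k K) Ks"
  have SEP_F: "set (?F b) \<subseteq> carrier_mat ?D ?D" if b: "b \<in> set bs" for b
  proof -
    obtain d' Ks P where b': "b = (d', Ks, P)" by (cases b)
    note v = valid_LocalD[OF 2(2) b[unfolded b']]
    have "effect (ds[k := d']) P i \<in> SEP (ds[k := d'])"
      by (rule effect_SEP[OF v(4) pos_update[OF 2(3) v(2)]])
    then show ?thesis unfolding b' using v 2(3) by (auto intro!: SEP_carrier SEP_congruence)
  qed
  have "outcome_prob ds (Local k bs) \<rho> i
      = (\<Sum>b\<leftarrow>bs. \<Sum>A\<leftarrow>?F b. mtrace (\<rho> * A))"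
    unfolding outcome_prob.simps
  proof (intro arg_cong[of _ _ sum_list] map_cong refl)
    fix b assume b: "b \<in> set bs"
    obtain d' Ks P where b': "b = (d', Ks, P)" by (cases b)
    note v = valid_LocalD[OF 2(2) b[unfolded b']]
    have E: "effect (ds[k := d']) P i \<in> SEP (ds[k := d'])"
      by (rule effect_SEP[OF v(4) pos_update[OF 2(3) v(2)]])
    have "outcome_prob (ds[k := d']) P (apply_kraus ds k d' Ks \<rho>) i
        = mtrace (apply_kraus ds k d' Ks \<rho> * effect (ds[k := d']) P i)"
      using 2(1)[OF b[unfolded b'] v(4) pos_update[OF 2(3) v(2)] apply_kraus_carrier[OF v(1,3) 2(4)]] .
    also have "\<dots> = (\<Sum>A\<leftarrow>?F b. mtrace (\<rho> * A))"
      unfolding mtrace_apply_kraus[OF v(1,3) 2(4) SEP_carrier[OF E]] b' by (simp add: comp_def)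
    finally show "(case b of (d', Ks, P) \<Rightarrow> outcome_prob (ds[k := d']) P (apply_kraus ds k d' Ks \<rho>) i)
        = (\<Sum>A\<leftarrow>?F b. mtrace (\<rho> * A))" unfolding b' by simp
  qed
  also have "\<dots> = (\<Sum>A\<leftarrow>concat (map ?F bs). mtrace (\<rho> * A))"
    by (simp add: sum_list_concat_map comp_def)
  also have "\<dots> = mtrace (\<rho> * sum_mats ?D (concat (map ?F bs)))"
  proof (intro mtrace_mult_sum_mats[OF 2(4), symmetric])
    show "set (concat (map ?F bs)) \<subseteq> carrier_mat ?D ?D"
      using SEP_F unfolding set_concat set_map by blast
  qed
  finally show ?case by simp
qed

lemma sum_sum_list_swap:
  fixes f :: "'a \<Rightarrow> 'b \<Rightarrow> 'c :: comm_monoid_add"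
  shows "(\<Sum>i\<in>I. \<Sum>x\<leftarrow>xs. f x i) = (\<Sum>x\<leftarrow>xs. \<Sum>i\<in>I. f x i)"
  by (induction xs) (auto simp: sum.distrib)

text \<open>The completeness relation of each instrument preserves the total trace from a node to
  its branches, and a leaf assigns its whole trace to one outcome.\<close>

lemma sum_outcome_prob:
  assumes "valid_protocol n ds P" "\<rho> \<in> carrier_mat (prod_list ds) (prod_list ds)"
  shows "(\<Sum>i\<le>n. outcome_prob ds P \<rho> i) = mtrace \<rho>"
  using assms
proof (induction ds P arbitrary: \<rho> rule: protocol_induct)
  case (1 ds i')
  then show ?case by simp
next
  case (2 ds k bs)
  let ?D = "prod_list ds"
  let ?Ks = "concat (map (\<lambda>(d', Ks, P). Ks) bs)"
  let ?G = "\<lambda>K. mat_adjoint (extend_op ds k K) * extend_op ds k K"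
  from 2(2) have k: "k < length ds"
    and sum1: "sum_mats (ds ! k) (map (\<lambda>K. mat_adjoint K * K) ?Ks) = 1\<^sub>m (ds ! k)" by auto
  have Ks: "\<exists>d'. K \<in> carrier_mat d' (ds ! k)" if "K \<in> set ?Ks" for K
    using that valid_LocalD(3)[OF 2(2)] by fastforce
  have G: "?G K = extend_op ds k (mat_adjoint K * K)" if K: "K \<in> set ?Ks" for K
    using Ks[OF K] extend_op_gram[OF k] by auto
  have gram_carr: "set (map (\<lambda>K. mat_adjoint K * K) ?Ks) \<subseteq> carrier_mat (ds ! k) (ds ! k)"
    using Ks by (fastforce intro!: mult_carrier_mat[OF mat_adjoint_carrier])
  have "sum_mats ?D (map ?G ?Ks) = sum_mats ?D (map (extend_op ds k) (map (\<lambda>K. mat_adjoint K * K) ?Ks))"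
    unfolding map_map comp_def using G by (intro arg_cong[of _ _ "sum_mats _"] map_cong) auto
  also have "\<dots> = extend_op ds k (1\<^sub>m (ds ! k))"
    unfolding extend_op_sum_mats[OF k gram_carr, symmetric] sum1 ..
  also have "\<dots> = 1\<^sub>m ?D"
  proof -
    have "(map (\<lambda>d. 1\<^sub>m d) ds)[k := 1\<^sub>m (ds ! k)] = (map (\<lambda>d. 1\<^sub>m d) ds :: complex mat list)"
      using k by (metis list_update_id map_update)
    then show ?thesis by (simp add: extend_op_def tensor_one)
  qed
  finally have id: "sum_mats ?D (map ?G ?Ks) = 1\<^sub>m ?D" .
  have "(\<Sum>i\<le>n. outcome_prob ds (Local k bs) \<rho> i)
      = (\<Sum>b\<leftarrow>bs. \<Sum>i\<le>n. case b of (d', Ks, P) \<Rightarrow> outcome_prob (ds[k := d']) P (apply_kraus ds k d' Ks \<rho>) i)"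
    by (simp add: sum_sum_list_swap)
  also have "\<dots> = (\<Sum>b\<leftarrow>bs. \<Sum>K\<leftarrow>(\<lambda>(d', Ks, P). Ks) b. mtrace (\<rho> * ?G K))"
  proof (intro arg_cong[of _ _ sum_list] map_cong refl)
    fix b assume b: "b \<in> set bs"
    obtain d' Ks P where b': "b = (d', Ks, P)" by (cases b)
    note v = valid_LocalD[OF 2(2) b[unfolded b']]
    let ?D' = "prod_list (ds[k := d'])"
    note carr = apply_kraus_carrier[OF v(1,3) 2(3)]
    have "(\<Sum>i\<le>n. outcome_prob (ds[k := d']) P (apply_kraus ds k d' Ks \<rho>) i)
        = mtrace (apply_kraus ds k d' Ks \<rho> * 1\<^sub>m ?D')"
      using 2(1)[OF b[unfolded b'] v(4) carr] carr by simp
    also have "\<dots> = (\<Sum>K\<leftarrow>Ks. mtrace (\<rho> * (mat_adjoint (extend_op ds k K) * 1\<^sub>m ?D' * extend_op ds k K)))"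
      by (rule mtrace_apply_kraus[OF v(1,3) 2(3)]) simp
    also have "\<dots> = (\<Sum>K\<leftarrow>Ks. mtrace (\<rho> * ?G K))"
    proof (intro arg_cong[of _ _ sum_list] map_cong refl)
      fix K assume "K \<in> set Ks"
      then have "extend_op ds k K \<in> carrier_mat ?D' ?D" using v by (intro extend_op_carrier) auto
      then have "mat_adjoint (extend_op ds k K) * 1\<^sub>m ?D' = mat_adjoint (extend_op ds k K)"
        by (rule right_mult_one_mat[OF mat_adjoint_carrier])
      then show "mtrace (\<rho> * (mat_adjoint (extend_op ds k K) * 1\<^sub>m ?D' * extend_op ds k K)) = mtrace (\<rho> * ?G K)"
        by simp
    qed
    finally show "(\<Sum>i\<le>n. case b of (d', Ks, P) \<Rightarrow> outcome_prob (ds[k := d']) P (apply_kraus ds k d' Ks \<rho>) i)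
      = (\<Sum>K\<leftarrow>(\<lambda>(d', Ks, P). Ks) b. mtrace (\<rho> * ?G K))" unfolding b' by simp
  qed
  also have "\<dots> = (\<Sum>K\<leftarrow>?Ks. mtrace (\<rho> * ?G K))"
    by (simp add: sum_list_concat_map comp_def)
  also have "\<dots> = mtrace (\<rho> * sum_mats ?D (map ?G ?Ks))"
  proof -
    have "set (map ?G ?Ks) \<subseteq> carrier_mat ?D ?D"
    proof -
      have "?G K \<in> carrier_mat ?D ?D" if "K \<in> set ?Ks" for K
        using Ks[OF that] extend_op_carrier[OF k] by (metis mult_carrier_mat[OF mat_adjoint_carrier])
      then show ?thesis unfolding set_map by blast
    qed
    from mtrace_mult_sum_mats[OF 2(3) this] show ?thesis by (simp add: comp_def)
  qed
  also have "\<dots> = mtrace \<rho>" unfolding id using 2(3) by simp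
  finally show ?case .
qed

section \<open>States separate matrices; LOCC protocols and their measurement operators\<close>

lemma quad_form_mtrace:
  assumes "A \<in> carrier_mat d d"
  shows "quad_form d A v = mtrace (mat d d (\<lambda>(i, j). v i * cnj (v j)) * A)"
proof -
  have "mtrace (mat d d (\<lambda>(i, j). v i * cnj (v j)) * A)
      = (\<Sum>i<d. \<Sum>j<d. v i * cnj (v j) * A $$ (j, i))"
    using assms by (subst mtrace_mult[of _ d d]) auto
  then show ?thesis unfolding quad_form_def
    by (subst sum.swap) (simp add: mult_ac)
qed

lemma psd_rank_one: "psd d (mat d d (\<lambda>(i, j). v i * cnj (v j)))"
proof -
  let ?K = "mat 1 d (\<lambda>(_, j). cnj (v j))"
  have "mat d d (\<lambda>(i, j). v i * cnj (v j)) = mat_adjoint ?K * ?K"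
    by (intro eq_matI) (auto simp: index_mult_mat_sum[of _ d 1 _ d] simp del: index_mult_mat(1))
  then show ?thesis using psd_gram[of ?K 1 d] by simp
qed

text \<open>A quadratic form is a trace against a rank-one positive matrix, hence a multiple of a
  trace against a state; polarisation does the rest. Dimension 0 is separate because it has no
  states.\<close>

lemma mat_eq_stateI:
  assumes A: "A \<in> carrier_mat d d" and B: "B \<in> carrier_mat d d"
    and eq: "\<And>\<rho>. state d \<rho> \<Longrightarrow> mtrace (\<rho> * A) = mtrace (\<rho> * B)"
  shows "A = B"
proof (cases "d = 0")
  case True
  then show ?thesis using A B by (intro eq_matI) auto
next
  case False
  show ?thesis
  proof (rule mat_eq_quad_formI[OF A B])
    fix v
    obtain p \<sigma> where p: "state d \<sigma>" "mat d d (\<lambda>(i, j). v i * cnj (v j)) = complex_of_real p \<cdot>\<^sub>m \<sigma>"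
      using psd_normalize[of d, OF _ psd_rank_one] False by blast
    have "mtrace ((c \<cdot>\<^sub>m \<sigma>) * E) = c * mtrace (\<sigma> * E)" if "E \<in> carrier_mat d d" for E c
      using that state_carrier[OF p(1)]
      by (simp add: mult_smult_assoc_mat[of _ d d _ d] mtrace_smult[of _ d])
    then show "quad_form d A v = quad_form d B v"
      using A B eq[OF p(1)] by (simp add: quad_form_mtrace p(2))
  qed
qed

text \<open>Positivity comes from separability of the effects. That they sum to the identity is
  tested on states, where it says that the outcome probabilities add up to the trace.\<close>

lemma LOCC_measurement_effect:
  assumes P: "valid_protocol n ds P" and pos: "\<forall>d \<in> set ds. 0 < d"
  shows "LOCC_measurement ds n (effect ds P)"
proof -
  let ?D = "prod_list ds"
  have E: "effect ds P i \<in> carrier_mat ?D ?D" for i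
    using SEP_carrier[OF effect_SEP[OF P pos]] .
  then have S: "set (map (effect ds P) [0..<Suc n]) \<subseteq> carrier_mat ?D ?D" by auto
  have "sum_mats ?D (map (effect ds P) [0..<Suc n]) = 1\<^sub>m ?D"
  proof (rule mat_eq_stateI[of _ ?D])
    fix \<rho> assume "state ?D \<rho>"
    then have \<rho>: "\<rho> \<in> carrier_mat ?D ?D" by (rule state_carrier)
    have "mtrace (\<rho> * sum_mats ?D (map (effect ds P) [0..<Suc n]))
        = (\<Sum>i\<leftarrow>[0..<Suc n]. mtrace (\<rho> * effect ds P i))"
      using mtrace_mult_sum_mats[OF \<rho> S] by (simp add: comp_def)
    also have "\<dots> = (\<Sum>i\<le>n. outcome_prob ds P \<rho> i)"
      by (simp only: interv_sum_list_conv_sum_set_nat outcome_prob_effect[OF P pos \<rho>]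
          atLeast0LessThan lessThan_Suc_atMost set_upt)
    also have "\<dots> = mtrace (\<rho> * 1\<^sub>m ?D)"
      using sum_outcome_prob[OF P \<rho>] \<rho> by simp
    finally show "mtrace (\<rho> * sum_mats ?D (map (effect ds P) [0..<Suc n])) = mtrace (\<rho> * 1\<^sub>m ?D)" .
  qed (use sum_mats_carrier[OF S] in auto)
  then show ?thesis
    unfolding LOCC_measurement_def measurement_def
    using SEP_psd[OF effect_SEP[OF P pos]] P outcome_prob_effect[OF P pos state_carrier] by blast
qed

lemma LOCC_imp_separable:
  assumes M: "LOCC_measurement ds n M" and pos: "\<forall>d \<in> set ds. 0 < d"
  shows "separable_measurement ds n M"
proof -
  let ?D = "prod_list ds"
  obtain P where P: "valid_protocol n ds P"
    "\<And>\<rho> i. state ?D \<rho> \<Longrightarrow> i \<le> n \<Longrightarrow> outcome_prob ds P \<rho> i = mtrace (\<rho> * M i)"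
    using M unfolding LOCC_measurement_def by blast
  have "M i = effect ds P i" if "i \<le> n" for i
  proof (rule mat_eq_stateI[of _ ?D])
    show "M i \<in> carrier_mat ?D ?D"
      using M that by (auto simp: LOCC_measurement_def measurement_def intro: psd_carrier)
    show "effect ds P i \<in> carrier_mat ?D ?D"
      using SEP_carrier[OF effect_SEP[OF P(1) pos]] .
    show "mtrace (\<rho> * M i) = mtrace (\<rho> * effect ds P i)" if "state ?D \<rho>" for \<rho>
      using P(2)[OF that \<open>i \<le> n\<close>] outcome_prob_effect[OF P(1) pos state_carrier[OF that]] by simp
  qed
  then show ?thesis
    using M effect_SEP[OF P(1) pos] by (auto simp: separable_measurement_def LOCC_measurement_def)
qed

section \<open>Implementing separable operators by LOCC\<close>

text \<open>
  Party after party applies its instrument \<open>{K, L}\<close>; the outcome is \<open>j\<close> if every party finds \<open>K\<close>,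
  and inconclusive as soon as one party finds \<open>L\<close>.
\<close>

fun product_test :: "nat list \<Rightarrow> nat \<Rightarrow> nat \<Rightarrow> (complex mat \<times> complex mat) list \<Rightarrow> protocol" where
  "product_test ds j k [] = Output j"
| "product_test ds j k ((K, L) # KLs) =
     Local k [(ds ! k, [K], product_test ds j (Suc k) KLs), (ds ! k, [L], Output 0)]"

definition binary_instrument :: "nat \<Rightarrow> complex mat \<times> complex mat \<Rightarrow> bool" where
  "binary_instrument d = (\<lambda>(K, L). K \<in> carrier_mat d d \<and> L \<in> carrier_mat d d
     \<and> mat_adjoint K * K + mat_adjoint L * L = 1\<^sub>m d)"

text \<open>The induction runs over the parties still to be tested. The remaining protocol does not
  touch the first \<open>k\<close> parties, so its effect has identities there; pulling back through
  \<open>K\<close> replaces the identity of the current party by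
  \<open>mat_adjoint K * K\<close>.\<close>

lemma product_test_effect:
  assumes "list_all2 binary_instrument (drop k ds) KLs" "k \<le> length ds" "j \<le> n" "j \<noteq> 0" "\<forall>d \<in> set ds. 0 < d"
  shows "valid_protocol n ds (product_test ds j k KLs)
    \<and> effect ds (product_test ds j k KLs) j
      = tensor (map (\<lambda>d. 1\<^sub>m d) (take k ds) @ map (\<lambda>(K, L). mat_adjoint K * K) KLs)"
  using assms(1,2)
proof (induction KLs arbitrary: k rule: list.induct)
  case Nil
  then have "drop k ds = []" by simp
  then have "k = length ds" using Nil(2) by (metis drop_eq_Nil le_antisym)
  then show ?case using assms(3) by (simp add: tensor_one)
next
  case (Cons KL KLs)
  obtain K L where KL: "KL = (K, L)" by (cases KL)
  have k: "k < length ds"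
    using Cons.prems list_all2_lengthD by fastforce
  have drop: "drop k ds = ds ! k # drop (Suc k) ds" using k by (simp add: Cons_nth_drop_Suc)
  from Cons.prems(1) have tl: "list_all2 binary_instrument (drop (Suc k) ds) KLs"
    and inst: "binary_instrument (ds ! k) (K, L)"
    by (auto simp: drop KL)
  from inst have K: "K \<in> carrier_mat (ds ! k) (ds ! k)" and L: "L \<in> carrier_mat (ds ! k) (ds ! k)"
    and sum: "mat_adjoint K * K + mat_adjoint L * L = 1\<^sub>m (ds ! k)"
    by (auto simp: binary_instrument_def)
  let ?next = "product_test ds j (Suc k) KLs" and ?D = "prod_list ds"
  let ?As = "map (\<lambda>d. 1\<^sub>m d) (take (Suc k) ds) @ map (\<lambda>(K, L). mat_adjoint K * K) KLs"
  have IH: "valid_protocol n ds ?next" "effect ds ?next j = tensor ?As"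
    using Cons.IH[OF tl] k by auto
  have "sum_mats (ds ! k) [mat_adjoint K * K, mat_adjoint L * L] = 1\<^sub>m (ds ! k)"
    using sum L mult_carrier_mat[OF mat_adjoint_carrier[OF L] L] by simp
  then have valid: "valid_protocol n ds (product_test ds j k (KL # KLs))"
    using k K L IH(1) assms(5) by (simp add: KL)
  have As: "list_all2 (\<lambda>d A. A \<in> carrier_mat d d) (ds[k := ds ! k]) ?As"
  proof -
    have "list_all2 (\<lambda>d A. A \<in> carrier_mat d d) (take (Suc k) ds) (map (\<lambda>d. 1\<^sub>m d :: complex mat) (take (Suc k) ds))"
      by (auto simp: list_all2_conv_all_nth)
    moreover have "list_all2 (\<lambda>d A. A \<in> carrier_mat d d) (drop (Suc k) ds) (map (\<lambda>(K, L). mat_adjoint K * K) KLs)"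
      unfolding list_all2_map2 using tl
      by (rule list_all2_mono) (auto simp: binary_instrument_def intro: mult_carrier_mat[OF mat_adjoint_carrier])
    ultimately have "list_all2 (\<lambda>d A. A \<in> carrier_mat d d) (take (Suc k) ds @ drop (Suc k) ds) ?As"
      by (rule list_all2_appendI)
    then show ?thesis by simp
  qed
  have "?As ! k = 1\<^sub>m (ds ! k)" using k by (simp add: nth_append)
  then have upd: "?As[k := mat_adjoint K * ?As ! k * K]
      = map (\<lambda>d. 1\<^sub>m d) (take k ds) @ map (\<lambda>(K, L). mat_adjoint K * K) (KL # KLs)"
    using k right_mult_one_mat[OF mat_adjoint_carrier[OF K]] by (simp add: KL take_Suc_conv_app_nth list_update_append)
  have X: "extend_op ds k M \<in> carrier_mat ?D ?D" if "M \<in> carrier_mat (ds ! k) (ds ! k)" for M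
    using extend_op_carrier[OF k, of M "ds ! k"] that by simp
  \<comment> \<open>The failure branch outputs 0, which differs from \<open>j\<close>, so it
    contributes nothing to this effect.\<close>
  have "mat_adjoint (extend_op ds k L) * 0\<^sub>m ?D ?D * extend_op ds k L = 0\<^sub>m ?D ?D"
    using X[OF L] by (simp add: right_mult_zero_mat[OF mat_adjoint_carrier])
  moreover have "mat_adjoint (extend_op ds k K) * tensor ?As * extend_op ds k K
      = tensor (?As[k := mat_adjoint K * ?As ! k * K])"
    by (rule tensor_congruence[OF k K As])
  moreover have "mat_adjoint (extend_op ds k K) * tensor ?As * extend_op ds k K \<in> carrier_mat ?D ?D"
    using mult_carrier_mat[OF mult_carrier_mat[OF mat_adjoint_carrier[OF X[OF K]]
        SEP_carrier[OF effect_SEP[OF IH(1) assms(5), of j]]] X[OF K]] unfolding IH(2) .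
  ultimately have "effect ds (product_test ds j k (KL # KLs)) j
      = tensor (map (\<lambda>d. 1\<^sub>m d) (take k ds) @ map (\<lambda>(K, L). mat_adjoint K * K) (KL # KLs))"
    using assms(4) IH(2) unfolding KL upd[unfolded KL] by simp
  then show ?case using valid by simp
qed

lemma product_test_exists:
  assumes pos: "\<forall>d \<in> set ds. 0 < d" and "list_all2 state ds \<sigma>s" and j: "j \<le> n" "j \<noteq> 0"
  shows "\<exists>P. valid_protocol n ds P \<and> effect ds P j = tensor \<sigma>s"
proof -
  have "\<exists>KLs. list_all2 binary_instrument ds KLs \<and> map (\<lambda>(K, L). mat_adjoint K * K) KLs = \<sigma>s"
    using assms(2)
  proof (induction rule: list_all2_induct)
    case (Cons d ds \<sigma> \<sigma>s)
    then obtain KLs where KLs: "list_all2 binary_instrument ds KLs"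
      "map (\<lambda>(K, L). mat_adjoint K * K) KLs = \<sigma>s" by blast
    obtain K where K: "K \<in> carrier_mat d d" "\<sigma> = mat_adjoint K * K"
      using psd_factor[of d \<sigma>] Cons(1) by (auto simp: state_def)
    \<comment> \<open>The failure operator is a factor of the complement of the state, which makes
      the instrument complete.\<close>
    obtain L where L: "L \<in> carrier_mat d d" "1\<^sub>m d - \<sigma> = mat_adjoint L * L"
      using psd_factor[OF state_complement_psd[OF Cons(1)]] .
    have "\<sigma> + (1\<^sub>m d - \<sigma>) = 1\<^sub>m d"
      using state_carrier[OF Cons(1)] by (intro eq_matI) auto
    then have "binary_instrument d (K, L)"
      using K L by (simp add: binary_instrument_def)
    with KLs K show ?case by (intro exI[of _ "(K, L) # KLs"]) simp
  qed simp
  then obtain KLs where "list_all2 binary_instrument ds KLs"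
    "map (\<lambda>(K, L). mat_adjoint K * K) KLs = \<sigma>s" by blast
  with product_test_effect[of 0 ds KLs j n] pos j show ?thesis by auto
qed

section \<open>Shared randomness and the realisation of separable operators\<close>

lemma extend_op_smult_one:
  assumes "k < length ds"
  shows "extend_op ds k (c \<cdot>\<^sub>m 1\<^sub>m (ds ! k)) = c \<cdot>\<^sub>m 1\<^sub>m (prod_list ds)"
  using assms
proof (induction ds arbitrary: k)
  case (Cons d ds)
  have one: "1 \<cdot>\<^sub>m A = A" for A :: "complex mat" by (intro eq_matI) auto
  show ?case
  proof (cases k)
    case 0
    then show ?thesis
      using kron_smult[of c "1\<^sub>m d" 1 "1\<^sub>m (prod_list ds)"]
      by (simp add: extend_op_def tensor_one one kron_one)
  next
    case (Suc l)
    then show ?thesis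
      using Cons.IH[of l] Cons.prems kron_smult[of 1 "1\<^sub>m d" c "1\<^sub>m (prod_list ds)"]
      by (simp add: extend_op_def one kron_one)
  qed
qed simp

text \<open>Party 0 tosses the coin and announces the result. The square root appears because a
  Kraus operator enters quadratically, so that a branch gets weight \<open>q\<close>; being scalar,
  the operator leaves the state unchanged up to this weight.\<close>

definition mixture :: "nat list \<Rightarrow> (real \<times> protocol) list \<Rightarrow> protocol" where
  "mixture ds qPs = Local 0
     (map (\<lambda>(q, P). (ds ! 0, [complex_of_real (sqrt q) \<cdot>\<^sub>m 1\<^sub>m (ds ! 0)], P)) qPs)"

lemma sqrt_smult_congruence:
  assumes "0 \<le> q" "A \<in> carrier_mat d d"
  shows "mat_adjoint (complex_of_real (sqrt q) \<cdot>\<^sub>m 1\<^sub>m d) * A * (complex_of_real (sqrt q) \<cdot>\<^sub>m 1\<^sub>m d)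
    = complex_of_real q \<cdot>\<^sub>m A"
proof -
  have "mat_adjoint (complex_of_real (sqrt q) \<cdot>\<^sub>m 1\<^sub>m d) = complex_of_real (sqrt q) \<cdot>\<^sub>m 1\<^sub>m d"
    by (intro eq_matI) auto
  moreover have "complex_of_real (sqrt q) * complex_of_real (sqrt q) = complex_of_real q"
    using assms(1) by (simp flip: of_real_mult)
  ultimately show ?thesis
    using carrier_matD[OF assms(2)] assms(2)
    by (simp add: smult_mult_dim mult_smult_dim smult_smult_mat)
qed

lemma mixture_effect:
  assumes ds: "ds \<noteq> []" "\<forall>d \<in> set ds. 0 < d"
    and qPs: "\<And>q P. (q, P) \<in> set qPs \<Longrightarrow> 0 \<le> q \<and> valid_protocol n ds P"
    and total: "(\<Sum>(q, P)\<leftarrow>qPs. q) = 1"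
  shows "valid_protocol n ds (mixture ds qPs)"
    and "effect ds (mixture ds qPs) i
      = sum_mats (prod_list ds) (map (\<lambda>(q, P). complex_of_real q \<cdot>\<^sub>m effect ds P i) qPs)"
proof -
  let ?d = "ds ! 0"
  \<comment> \<open>Stated for an arbitrary total weight to allow induction on the list;
    \<open>total\<close> is inserted only afterwards.\<close>
  have "sum_mats ?d (map (\<lambda>(q, P). mat_adjoint (complex_of_real (sqrt q) \<cdot>\<^sub>m 1\<^sub>m ?d)
      * (complex_of_real (sqrt q) \<cdot>\<^sub>m 1\<^sub>m ?d)) qPs) = complex_of_real (\<Sum>(q, P)\<leftarrow>qPs. q) \<cdot>\<^sub>m 1\<^sub>m ?d"
    using qPs
  proof (induction qPs)
    case Nil
    show ?case by (intro eq_matI) auto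
  next
    case (Cons qP qPs)
    obtain q P where qP: "qP = (q, P)" by (cases qP)
    have "0 \<le> q" using Cons.prems[of q P] qP by simp
    then have "mat_adjoint (complex_of_real (sqrt q) \<cdot>\<^sub>m 1\<^sub>m ?d) * (complex_of_real (sqrt q) \<cdot>\<^sub>m 1\<^sub>m ?d)
        = complex_of_real q \<cdot>\<^sub>m 1\<^sub>m ?d"
      using sqrt_smult_congruence[of q "1\<^sub>m ?d" ?d] by (simp add: right_mult_one_mat[OF mat_adjoint_carrier])
    moreover have "sum_mats ?d (map (\<lambda>(q, P). mat_adjoint (complex_of_real (sqrt q) \<cdot>\<^sub>m 1\<^sub>m ?d)
      * (complex_of_real (sqrt q) \<cdot>\<^sub>m 1\<^sub>m ?d)) qPs) = complex_of_real (\<Sum>(q, P)\<leftarrow>qPs. q) \<cdot>\<^sub>m 1\<^sub>m ?d"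
      by (rule Cons.IH) (use Cons.prems in auto)
    ultimately show ?case
      by (simp add: qP add_smult_distrib_right_mat[of _ ?d ?d])
  qed
  moreover have "concat (map (\<lambda>(d', Ks, P). Ks)
      (map (\<lambda>(q, P). (?d, [complex_of_real (sqrt q) \<cdot>\<^sub>m 1\<^sub>m ?d], P)) qPs))
    = map (\<lambda>(q, P). complex_of_real (sqrt q) \<cdot>\<^sub>m 1\<^sub>m ?d) qPs"
    by (induction qPs) auto
  moreover have "complex_of_real 1 \<cdot>\<^sub>m 1\<^sub>m ?d = 1\<^sub>m ?d" by (intro eq_matI) auto
  ultimately have "sum_mats ?d (map (\<lambda>K. mat_adjoint K * K) (concat (map (\<lambda>(d', Ks, P). Ks)
      (map (\<lambda>(q, P). (?d, [complex_of_real (sqrt q) \<cdot>\<^sub>m 1\<^sub>m ?d], P)) qPs)))) = 1\<^sub>m ?d"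
    unfolding total by (simp add: comp_def case_prod_unfold)
  then show "valid_protocol n ds (mixture ds qPs)"
    unfolding mixture_def valid_protocol.simps using ds qPs by auto
  let ?D = "prod_list ds"
  have "effect ds (mixture ds qPs) i = sum_mats ?D (concat (map (\<lambda>(q, P).
      [complex_of_real q \<cdot>\<^sub>m effect ds P i]) qPs))"
    unfolding mixture_def effect.simps map_map
  proof (intro arg_cong[of _ _ "sum_mats _"] arg_cong[of _ _ concat] map_cong refl)
    fix qP assume mem: "qP \<in> set qPs"
    obtain q P where qP: "qP = (q, P)" by (cases qP)
    have q: "0 \<le> q" "valid_protocol n ds P" using qPs mem qP by auto
    have "effect ds P i \<in> carrier_mat ?D ?D" using SEP_carrier[OF effect_SEP[OF q(2) ds(2)]] .
    from sqrt_smult_congruence[OF q(1) this]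
    show "((\<lambda>(d', Ks, P). map (\<lambda>K. mat_adjoint (extend_op ds 0 K) * effect (ds[0 := d']) P i * extend_op ds 0 K) Ks)
        \<circ> (\<lambda>(q, P). (ds ! 0, [complex_of_real (sqrt q) \<cdot>\<^sub>m 1\<^sub>m (ds ! 0)], P))) qP
      = (case qP of (q, P) \<Rightarrow> [complex_of_real q \<cdot>\<^sub>m effect ds P i])"
      using ds by (simp add: qP extend_op_smult_one)
  qed
  also have "concat (map (\<lambda>(q, P). [complex_of_real q \<cdot>\<^sub>m effect ds P i]) qPs)
      = map (\<lambda>(q, P). complex_of_real q \<cdot>\<^sub>m effect ds P i) qPs"
    by (induction qPs) auto
  finally show "effect ds (mixture ds qPs) i = sum_mats ?D (map (\<lambda>(q, P). complex_of_real q \<cdot>\<^sub>m effect ds P i) qPs)" .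
qed

lemma SEP_LOCC_realization:
  assumes ds: "ds \<noteq> []" "\<forall>d \<in> set ds. 0 < d" and M: "M \<in> SEP ds" "M \<noteq> 0\<^sub>m (prod_list ds) (prod_list ds)"
    and j: "j \<le> n" "j \<noteq> 0"
  obtains P s where "0 < s" "valid_protocol n ds P" "effect ds P j = complex_of_real (1 / s) \<cdot>\<^sub>m M"
proof -
  let ?D = "prod_list ds"
  let ?g = "\<lambda>(p, \<sigma>s). complex_of_real p \<cdot>\<^sub>m tensor \<sigma>s"
  obtain ts where ts: "\<And>p \<sigma>s. (p, \<sigma>s) \<in> set ts \<Longrightarrow> 0 \<le> p \<and> list_all2 state ds \<sigma>s"
    "M = sum_mats ?D (map ?g ts)"
    using SEP_decompose[OF M(1)] by blast
  have carr: "set (map ?g ts) \<subseteq> carrier_mat ?D ?D"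
    using ts(1) by (auto intro!: smult_carrier_mat tensor_psd_carrier list_all2_state_psd)
  \<comment> \<open>Product states have unit trace, so \<open>s\<close> is the trace of
    \<open>M\<close>, which is positive for a nonzero positive matrix. Hence the weights can be
    divided by it to form probabilities.\<close>
  define s where "s = (\<Sum>(p, \<sigma>s)\<leftarrow>ts. p)"
  have "mtrace M = (\<Sum>t\<leftarrow>ts. mtrace (?g t))"
    unfolding ts(2) mtrace_sum_mats[OF carr] by (simp add: comp_def)
  also have "\<dots> = (\<Sum>t\<leftarrow>ts. complex_of_real (fst t))"
  proof (intro arg_cong[of _ _ sum_list] map_cong refl)
    fix t assume "t \<in> set ts"
    then have "state ?D (tensor (snd t))" using ts(1)[of "fst t" "snd t"] by (intro state_tensor) simp
    then show "mtrace (?g t) = complex_of_real (fst t)"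
      using mtrace_smult[OF state_carrier, of ?D "tensor (snd t)"]
      by (simp add: case_prod_unfold state_def)
  qed
  also have "\<dots> = complex_of_real s"
    unfolding s_def by (induction ts) auto
  finally have tr: "mtrace M = complex_of_real s" .
  have "s \<noteq> 0" using psd_mtrace(2)[OF SEP_psd[OF M(1)]] M(2) tr by auto
  moreover have "0 \<le> s" using psd_mtrace(1)[OF SEP_psd[OF M(1)]] tr by (simp add: less_eq_complex_def)
  ultimately have s: "0 < s" by simp
  have "\<forall>t \<in> set ts. \<exists>P. valid_protocol n ds P \<and> effect ds P j = tensor (snd t)"
    using product_test_exists[OF ds(2) _ j] ts(1) by force
  then obtain Q where Q: "\<And>t. t \<in> set ts \<Longrightarrow> valid_protocol n ds (Q t) \<and> effect ds (Q t) j = tensor (snd t)"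
    by metis
  define qPs where "qPs = map (\<lambda>t. (fst t / s, Q t)) ts"
  have qPs: "0 \<le> q \<and> valid_protocol n ds P" if "(q, P) \<in> set qPs" for q P
    using that Q ts(1) s unfolding qPs_def by fastforce
  have "(\<Sum>(q, P)\<leftarrow>qPs. q) = (\<Sum>(p, \<sigma>s)\<leftarrow>ts. p) / s"
    unfolding qPs_def by (induction ts) (auto simp: add_divide_distrib)
  then have total: "(\<Sum>(q, P)\<leftarrow>qPs. q) = 1" using s by (simp add: s_def)
  have mix: "valid_protocol n ds (mixture ds qPs)"
    "effect ds (mixture ds qPs) j
      = sum_mats ?D (map (\<lambda>(q, P). complex_of_real q \<cdot>\<^sub>m effect ds P j) qPs)"
    using mixture_effect[OF ds _ total] qPs by blast+
  have "effect ds (mixture ds qPs) j = sum_mats ?D (map (\<lambda>A. complex_of_real (1 / s) \<cdot>\<^sub>m A) (map ?g ts))"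
    unfolding mix(2)
    unfolding qPs_def map_map
    using Q by (intro arg_cong[of _ _ "sum_mats _"] map_cong) (auto simp: smult_smult_mat)
  also have "\<dots> = complex_of_real (1 / s) \<cdot>\<^sub>m M"
    unfolding ts(2) by (rule smult_sum_mats[OF carr, symmetric])
  finally show ?thesis using that[OF s mix(1)] by blast
qed

section \<open>Equality of the three sets of values\<close>

lemma avg_state_psd:
  assumes "ensemble ds n \<eta> \<rho>"
  shows "psd (prod_list ds) (avg_state ds n \<eta> \<rho>)"
  unfolding avg_state_def
proof (rule psd_sum_mats)
  fix A assume "A \<in> set (map (\<lambda>i. complex_of_real (\<eta> i) \<cdot>\<^sub>m \<rho> i) [1..<Suc n])"
  then obtain i where "i \<in> set [1..<Suc n]" and A: "A = complex_of_real (\<eta> i) \<cdot>\<^sub>m \<rho> i"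
    by (auto simp del: upt_Suc)
  then have i: "i \<in> {1..n}" by auto
  with assms have "0 < \<eta> i" "psd (prod_list ds) (\<rho> i)" by (auto simp: ensemble_def state_def)
  then show "psd (prod_list ds) A" unfolding A by (intro psd_smult) auto
qed

text \<open>The inclusions form a cycle: LOCC, separable measurements, normalised separable
  operators, LOCC. The last two replace the operator for \<open>j\<close> by a positive multiple,
  which cancels in the ratio.\<close>

lemma values_eq:
  assumes ds: "ds \<noteq> []" "\<forall>d \<in> set ds. 0 < d" and ens: "ensemble ds n \<eta> \<rho>" and j: "j \<in> {1..n}"
  shows "locc_values ds n \<eta> \<rho> j = sep_values ds n \<eta> \<rho> j"
    and "sep_values ds n \<eta> \<rho> j = sep_operator_values ds n \<eta> \<rho> j"
proof -
  let ?D = "prod_list ds" and ?\<rho>0 = "avg_state ds n \<eta> \<rho>"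
  have \<rho>0: "psd ?D ?\<rho>0" by (rule avg_state_psd[OF ens])
  have \<rho>j: "\<rho> j \<in> carrier_mat ?D ?D"
    using ens j by (auto simp: ensemble_def state_carrier)
  have 1: "locc_values ds n \<eta> \<rho> j \<subseteq> sep_values ds n \<eta> \<rho> j"
    unfolding locc_values_def sep_values_def using LOCC_imp_separable[OF _ ds(2)] by blast
  have 2: "sep_values ds n \<eta> \<rho> j \<subseteq> sep_operator_values ds n \<eta> \<rho> j"
  proof
    fix x assume "x \<in> sep_values ds n \<eta> \<rho> j"
    then obtain M where M: "separable_measurement ds n M" "mtrace (?\<rho>0 * M j) \<noteq> 0"
      and x: "x = confidence ds n \<eta> \<rho> j M" unfolding sep_values_def by blast
    have Mj: "M j \<in> SEP ds" using M(1) j by (auto simp: separable_measurement_def)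
    obtain t where t: "mtrace (?\<rho>0 * M j) = complex_of_real t" "0 < t"
      \<comment> \<open>The trace of a product of two positive matrices is real and nonnegative, so
        a nonzero one is positive and admits rescaling by its inverse.\<close>
      using psd_mtrace_mult(1)[OF \<rho>0 SEP_psd[OF Mj]] M(2)
      by (intro that[of "Re (mtrace (?\<rho>0 * M j))"]) (auto simp: less_eq_complex_def complex_eq_iff)
    let ?N = "complex_of_real (1 / t) \<cdot>\<^sub>m M j"
    have "?N \<in> SEP ds" using t by (intro SEP_smult[OF Mj _ ds(2)]) simp
    moreover have "mtrace (?\<rho>0 * ?N) = 1"
      using t by (subst mtrace_mult_smult[OF psd_carrier[OF \<rho>0] SEP_carrier[OF Mj]]) simp
    moreover have "x = \<eta> j * Re (mtrace (\<rho> j * ?N))"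
      unfolding x confidence_def t(1)
      by (subst mtrace_mult_smult[OF \<rho>j SEP_carrier[OF Mj]]) (simp add: Re_divide_of_real)
    ultimately show "x \<in> sep_operator_values ds n \<eta> \<rho> j"
      unfolding sep_operator_values_def by blast
  qed
  have 3: "sep_operator_values ds n \<eta> \<rho> j \<subseteq> locc_values ds n \<eta> \<rho> j"
  proof
    fix x assume "x \<in> sep_operator_values ds n \<eta> \<rho> j"
    then obtain M where M: "M \<in> SEP ds" "mtrace (?\<rho>0 * M) = 1" and x: "x = \<eta> j * Re (mtrace (\<rho> j * M))"
      unfolding sep_operator_values_def by blast
    have "mtrace (?\<rho>0 * 0\<^sub>m ?D ?D) = 0"
      using psd_carrier[OF \<rho>0] by (simp add: mtrace_def)
    with M(2) have nz: "M \<noteq> 0\<^sub>m ?D ?D" by auto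
    have j': "j \<le> n" "j \<noteq> 0" using j by auto
    obtain P s where P: "0 < s" "valid_protocol n ds P" "effect ds P j = complex_of_real (1 / s) \<cdot>\<^sub>m M"
      using SEP_LOCC_realization[OF ds M(1) nz j'] by blast
    have "LOCC_measurement ds n (effect ds P)"
      by (rule LOCC_measurement_effect[OF P(2) ds(2)])
    moreover have tr: "mtrace (?\<rho>0 * effect ds P j) = complex_of_real (1 / s)"
      using M(2) by (simp only: P(3) mtrace_mult_smult[OF psd_carrier[OF \<rho>0] SEP_carrier[OF M(1)]]) simp
    moreover have "x = confidence ds n \<eta> \<rho> j (effect ds P)"
      unfolding x confidence_def tr
      unfolding P(3) mtrace_mult_smult[OF \<rho>j SEP_carrier[OF M(1)]]
      using P(1) by simp
    moreover have "mtrace (?\<rho>0 * effect ds P j) \<noteq> 0" using tr P(1) by simp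
    ultimately show "x \<in> locc_values ds n \<eta> \<rho> j"
      unfolding locc_values_def by blast
  qed
  show "locc_values ds n \<eta> \<rho> j = sep_values ds n \<eta> \<rho> j"
    "sep_values ds n \<eta> \<rho> j = sep_operator_values ds n \<eta> \<rho> j"
    using 1 2 3 by blast+
qed

section \<open>Attainment for an invertible average state\<close>

text \<open>
  The entry \<open>f (k, r, c)\<close> is the entry \<open>(r, c)\<close> of a factor \<open>K\<close> of the \<open>k\<close>-th local state
  \<open>K\<^sup>\<dagger> K\<close>. In these coordinates positivity is automatic and unit trace means that the entries of each
  \<open>K\<close> lie on a sphere, so that Tychonoff's theorem applies.
\<close>

definition local_gram :: "nat \<Rightarrow> nat \<Rightarrow> (nat \<times> nat \<times> nat \<Rightarrow> complex) \<Rightarrow> complex mat" where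
  "local_gram d k f = mat d d (\<lambda>(i, j). \<Sum>r<d. cnj (f (k, r, i)) * f (k, r, j))"

definition factor_sphere :: "nat list \<Rightarrow> (nat \<times> nat \<times> nat \<Rightarrow> complex) set" where
  "factor_sphere ds = {f. (\<forall>x. f x \<in> cball 0 1)
     \<and> (\<forall>k<length ds. (\<Sum>r<ds ! k. \<Sum>c<ds ! k. (cmod (f (k, r, c)))\<^sup>2) = 1)}"

lemma local_gram_eq:
  "local_gram d k f = mat_adjoint (mat d d (\<lambda>(r, c). f (k, r, c))) * mat d d (\<lambda>(r, c). f (k, r, c))"
proof (rule eq_matI, goal_cases)
  case (1 i j)
  then have "i < d" "j < d" by auto
  then show ?case
    by (subst index_mult_mat_sum[of _ d d _ d]) (auto simp: local_gram_def)
qed (auto simp: local_gram_def)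

lemma continuous_on_coordinate: "continuous_on S (\<lambda>f. f x)"
  by (rule continuous_on_subset[OF continuous_on_product_coordinates]) simp

text \<open>The disc bound holds for every index triple, including those that belong to no matrix
  entry. The set is therefore a closed part of a full product of compact discs.\<close>

lemma compact_factor_sphere: "compact (factor_sphere ds)"
proof -
  have "compactin (product_topology (\<lambda>_. euclidean) UNIV)
      (PiE UNIV (\<lambda>_ :: nat \<times> nat \<times> nat. cball (0 :: complex) 1))"
    unfolding compactin_PiE by (auto simp: compactin_euclidean_iff)
  then have "compact (PiE UNIV (\<lambda>_ :: nat \<times> nat \<times> nat. cball (0 :: complex) 1))"
    by (simp add: euclidean_product_topology)
  moreover have "closed (\<Inter>k<length ds. {f :: nat \<times> nat \<times> nat \<Rightarrow> complex.
      (\<Sum>r<ds ! k. \<Sum>c<ds ! k. (cmod (f (k, r, c)))\<^sup>2) = 1})"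
  proof (intro closed_INT ballI)
    fix k
    have "continuous_on UNIV (\<lambda>f :: nat \<times> nat \<times> nat \<Rightarrow> complex.
        \<Sum>r<ds ! k. \<Sum>c<ds ! k. (cmod (f (k, r, c)))\<^sup>2)"
      by (intro continuous_on_sum continuous_on_power continuous_on_norm continuous_on_coordinate)
    then show "closed {f :: nat \<times> nat \<times> nat \<Rightarrow> complex.
        (\<Sum>r<ds ! k. \<Sum>c<ds ! k. (cmod (f (k, r, c)))\<^sup>2) = 1}"
      by (rule closed_Collect_eq[OF _ continuous_on_const])
  qed
  moreover have "factor_sphere ds = PiE UNIV (\<lambda>_. cball 0 1) \<inter> (\<Inter>k<length ds. {f.
      (\<Sum>r<ds ! k. \<Sum>c<ds ! k. (cmod (f (k, r, c)))\<^sup>2) = 1})"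
    unfolding factor_sphere_def by (auto simp: PiE_UNIV_domain)
  ultimately show ?thesis by (simp only: compact_Int_closed)
qed

lemma state_local_gram:
  assumes "f \<in> factor_sphere ds" "k < length ds"
  shows "state (ds ! k) (local_gram (ds ! k) k f)"
  using assms unfolding state_def local_gram_eq
  by (simp add: psd_gram[of _ "ds ! k"] mtrace_gram[of _ "ds ! k" "ds ! k"] factor_sphere_def)

text \<open>The coordinates reach every product state: factorise each local state; unit trace yields
  the sphere conditions, and these bound each single entry by 1.\<close>

lemma product_state_factor:
  assumes "list_all2 state ds \<sigma>s"
  obtains f where "f \<in> factor_sphere ds" "\<sigma>s = map (\<lambda>k. local_gram (ds ! k) k f) [0..<length ds]"
proof -
  have "\<forall>k. \<exists>K. k < length ds \<longrightarrow> K \<in> carrier_mat (ds ! k) (ds ! k) \<and> \<sigma>s ! k = mat_adjoint K * K"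
  proof
    fix k
    show "\<exists>K. k < length ds \<longrightarrow> K \<in> carrier_mat (ds ! k) (ds ! k) \<and> \<sigma>s ! k = mat_adjoint K * K"
    proof (cases "k < length ds")
      case True
      then have "psd (ds ! k) (\<sigma>s ! k)" using list_all2_nthD[OF assms] by (simp add: state_def)
      then show ?thesis using psd_factor by metis
    qed simp
  qed
  then obtain K where K: "\<And>k. k < length ds \<Longrightarrow> K k \<in> carrier_mat (ds ! k) (ds ! k)"
    "\<And>k. k < length ds \<Longrightarrow> \<sigma>s ! k = mat_adjoint (K k) * K k" by metis
  \<comment> \<open>The default 0 keeps the coordinates without a matrix entry inside the unit
    disc.\<close>
  define f where "f = (\<lambda>(k, r, c). if k < length ds \<and> r < ds ! k \<and> c < ds ! k then K k $$ (r, c) else 0)"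
  have K_eq: "mat (ds ! k) (ds ! k) (\<lambda>(r, c). f (k, r, c)) = K k" if "k < length ds" for k
    using K(1)[OF that] that by (intro eq_matI) (auto simp: f_def)
  have norm: "(\<Sum>r<ds ! k. \<Sum>c<ds ! k. (cmod (K k $$ (r, c)))\<^sup>2) = 1" if k: "k < length ds" for k
  proof -
    have "mtrace (\<sigma>s ! k) = 1" using list_all2_nthD[OF assms k] by (simp add: state_def)
    then show ?thesis unfolding K(2)[OF k] mtrace_gram[OF K(1)[OF k]] of_real_eq_1_iff .
  qed
  have "cmod (f (k, r, c)) \<le> 1" for k r c
  proof (cases "k < length ds \<and> r < ds ! k \<and> c < ds ! k")
    case True
    have "(cmod (K k $$ (r, c)))\<^sup>2 \<le> (\<Sum>c<ds ! k. (cmod (K k $$ (r, c)))\<^sup>2)"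
      using True by (intro member_le_sum) auto
    also have "\<dots> \<le> (\<Sum>r<ds ! k. \<Sum>c<ds ! k. (cmod (K k $$ (r, c)))\<^sup>2)"
      using True by (intro member_le_sum[where f = "\<lambda>r. \<Sum>c<ds ! k. (cmod (K k $$ (r, c)))\<^sup>2"])
        (auto intro: sum_nonneg)
    finally have "(cmod (K k $$ (r, c)))\<^sup>2 \<le> 1\<^sup>2" using norm True by simp
    then have "cmod (K k $$ (r, c)) \<le> 1" by (rule power2_le_imp_le) simp
    then show ?thesis using True by (simp add: f_def)
  qed (auto simp: f_def)
  then have "f \<in> factor_sphere ds"
    using norm by (auto simp: factor_sphere_def f_def)
  moreover have "\<sigma>s = map (\<lambda>k. local_gram (ds ! k) k f) [0..<length ds]"
    using list_all2_lengthD[OF assms] K(2)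
    by (intro nth_equalityI) (auto simp: local_gram_eq K_eq)
  ultimately show ?thesis using that by blast
qed

text \<open>Continuity is treated entrywise: an entry of a Kronecker product is a product of one
  entry of each factor.\<close>

lemma continuous_on_tensor:
  assumes "list_all2 (\<lambda>d F. (\<forall>x. F x \<in> carrier_mat d d)
      \<and> (\<forall>i<d. \<forall>j<d. continuous_on S (\<lambda>x. F x $$ (i, j)))) ds Fs"
    and "i < prod_list ds" "j < prod_list ds"
  shows "continuous_on S (\<lambda>x. tensor (map (\<lambda>F. F x) Fs) $$ (i, j))"
  using assms
proof (induction arbitrary: i j rule: list_all2_induct)
  case (Cons d ds F Fs)
  have tl: "tensor (map (\<lambda>F. F x) Fs) \<in> carrier_mat (prod_list ds) (prod_list ds)" for x
  proof -
    have "map dim_row (map (\<lambda>F. F x) Fs) = ds" "map dim_col (map (\<lambda>F. F x) Fs) = ds"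
      using Cons(2) by (induction rule: list_all2_induct) auto
    then show ?thesis by (intro carrier_matI) (simp_all only: dim_tensor)
  qed
  let ?D = "prod_list ds"
  have ij: "i < d * ?D" "j < d * ?D" using Cons.prems by auto
  note div_mod = ij[THEN less_mult_imp_div_less] ij[THEN mod_less_of_less_mult]
  have hd: "F x \<in> carrier_mat d d" for x using Cons(1) by blast
  have "tensor (map (\<lambda>F. F x) (F # Fs)) $$ (i, j)
      = F x $$ (i div ?D, j div ?D) * tensor (map (\<lambda>F. F x) Fs) $$ (i mod ?D, j mod ?D)" for x
    using carrier_matD[OF tl[of x]] carrier_matD[OF hd[of x]] ij
    by (simp del: dim_tensor)
  moreover have "continuous_on S (\<lambda>x. F x $$ (i div ?D, j div ?D)
      * tensor (map (\<lambda>F. F x) Fs) $$ (i mod ?D, j mod ?D))"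
    using Cons(1) div_mod by (intro continuous_on_mult Cons.IH) auto
  ultimately show ?case by (simp only:)
qed simp

lemma product_state_ratio_attains_max:
  assumes pos: "\<forall>d \<in> set ds. 0 < d"
    and A: "A \<in> carrier_mat (prod_list ds) (prod_list ds)"
    and B: "B \<in> carrier_mat (prod_list ds) (prod_list ds)"
    and den: "\<And>\<sigma>s. list_all2 state ds \<sigma>s \<Longrightarrow> 0 < Re (mtrace (B * tensor \<sigma>s))"
  obtains \<sigma>s where "list_all2 state ds \<sigma>s"
    "\<And>\<tau>s. list_all2 state ds \<tau>s \<Longrightarrow> Re (mtrace (A * tensor \<tau>s)) / Re (mtrace (B * tensor \<tau>s))
      \<le> Re (mtrace (A * tensor \<sigma>s)) / Re (mtrace (B * tensor \<sigma>s))"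
proof -
  let ?D = "prod_list ds" and ?C = "factor_sphere ds"
  let ?Fs = "map (\<lambda>k. local_gram (ds ! k) k) [0..<length ds]"
  define T where "T f = tensor (map (\<lambda>k. local_gram (ds ! k) k f) [0..<length ds])" for f
  have T_eq: "T f = tensor (map (\<lambda>F. F f) ?Fs)" for f by (simp add: T_def comp_def)
  have states: "list_all2 state ds (map (\<lambda>k. local_gram (ds ! k) k f) [0..<length ds])"
    if "f \<in> ?C" for f
    using state_local_gram[OF that] by (simp add: list_all2_conv_all_nth)
  have T_carr: "T f \<in> carrier_mat ?D ?D" if "f \<in> ?C" for f
    unfolding T_def by (intro tensor_psd_carrier list_all2_state_psd states that)
  have "list_all2 (\<lambda>d F. (\<forall>f. F f \<in> carrier_mat d d)
      \<and> (\<forall>i<d. \<forall>j<d. continuous_on ?C (\<lambda>f. F f $$ (i, j)))) ds ?Fs"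
    by (auto simp: list_all2_conv_all_nth local_gram_def
        intro!: continuous_on_sum continuous_on_mult continuous_on_cnj continuous_on_coordinate)
  note cont_T = continuous_on_tensor[OF this, folded T_eq]
  have cont: "continuous_on ?C (\<lambda>f. Re (mtrace (E * T f)))" if E: "E \<in> carrier_mat ?D ?D" for E
  proof -
    have "continuous_on ?C (\<lambda>f. Re (\<Sum>i<?D. \<Sum>j<?D. E $$ (i, j) * T f $$ (j, i)))"
      by (intro continuous_on_Re continuous_on_sum continuous_on_mult continuous_on_const cont_T) auto
    moreover have "Re (\<Sum>i<?D. \<Sum>j<?D. E $$ (i, j) * T f $$ (j, i)) = Re (mtrace (E * T f))"
      if "f \<in> ?C" for f
      using mtrace_mult[OF E T_carr[OF that]] by simp
    ultimately show ?thesis by (rule continuous_on_eq)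
  qed
  \<comment> \<open>Positivity of the denominator on all product states is what makes the ratio
    continuous on the whole compact set.\<close>
  have "continuous_on ?C (\<lambda>f. Re (mtrace (A * T f)) / Re (mtrace (B * T f)))"
    using den[OF states] by (intro continuous_on_divide cont A B) (force simp: T_def)
  moreover have "?C \<noteq> {}"
  proof -
    have "\<exists>\<sigma>s. list_all2 state ds \<sigma>s"
      using tensor_normalize[of ds "map (\<lambda>d. 1\<^sub>m d) ds"] pos by (auto simp: list_all2_conv_all_nth)
    then show ?thesis using product_state_factor by (metis empty_iff)
  qed
  ultimately obtain f where f: "f \<in> ?C"
    "\<And>g. g \<in> ?C \<Longrightarrow> Re (mtrace (A * T g)) / Re (mtrace (B * T g)) \<le> Re (mtrace (A * T f)) / Re (mtrace (B * T f))"
    using continuous_attains_sup[OF compact_factor_sphere] by blast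
  show ?thesis
  proof (rule that[OF states[OF f(1)]])
    fix \<tau>s assume "list_all2 state ds \<tau>s"
    then obtain g where g: "g \<in> ?C" "\<tau>s = map (\<lambda>k. local_gram (ds ! k) k g) [0..<length ds]"
      using product_state_factor by blast
    show "Re (mtrace (A * tensor \<tau>s)) / Re (mtrace (B * tensor \<tau>s))
        \<le> Re (mtrace (A * tensor (map (\<lambda>k. local_gram (ds ! k) k f) [0..<length ds])))
          / Re (mtrace (B * tensor (map (\<lambda>k. local_gram (ds ! k) k f) [0..<length ds])))"
      using f(2)[OF g(1)] unfolding T_def g(2) .
  qed
qed

text \<open>A vanishing trace would force \<open>B * \<sigma>\<close> to be zero, and multiplying by
  the inverse would give \<sigma> = 0, against its unit trace.\<close>

lemma psd_invertible_mtrace_pos: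
  assumes B: "psd d B" "invertible_mat B" and \<sigma>: "state d \<sigma>"
  shows "0 < Re (mtrace (B * \<sigma>))"
proof -
  have \<sigma>': "psd d \<sigma>" "mtrace \<sigma> = 1" using \<sigma> by (auto simp: state_def)
  have "mtrace (B * \<sigma>) \<noteq> 0"
  proof
    assume "mtrace (B * \<sigma>) = 0"
    then have zero: "B * \<sigma> = 0\<^sub>m d d" by (rule psd_mtrace_mult(2)[OF B(1) \<sigma>'(1)])
    obtain C where C: "C * B = 1\<^sub>m (dim_row C)" "B * C = 1\<^sub>m (dim_row B)"
      using B(2) unfolding invertible_mat_def inverts_mat_def by blast
    have Bd: "B \<in> carrier_mat d d" by (rule psd_carrier[OF B(1)])
    \<comment> \<open>The inverse comes without a stated shape; its dimensions are read off from the
      two identities.\<close>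
    have "dim_col (B * C) = d" using C(2) Bd by simp
    moreover have "dim_row C = d"
    proof -
      have "dim_col (C * B) = dim_row C" using C(1) by simp
      then show ?thesis using Bd by simp
    qed
    ultimately have Cd: "C \<in> carrier_mat d d" by auto
    have "\<sigma> = C * B * \<sigma>" using C(1) Cd state_carrier[OF \<sigma>] by simp
    also have "\<dots> = 0\<^sub>m d d" using Cd Bd state_carrier[OF \<sigma>] by (simp add: assoc_mult_mat[of C d d B d \<sigma> d] zero)
    finally show False using \<sigma>'(2) by (simp add: mtrace_def)
  qed
  moreover have "0 \<le> mtrace (B * \<sigma>)" by (rule psd_mtrace_mult(1)[OF B(1) \<sigma>'(1)])
  ultimately show ?thesis by (auto simp: less_eq_complex_def complex_eq_iff)
qed

lemma sep_operator_values_attained: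
  assumes pos: "\<forall>d \<in> set ds. 0 < d" and ens: "ensemble ds n \<eta> \<rho>" and j: "j \<in> {1..n}"
    and inv: "invertible_mat (avg_state ds n \<eta> \<rho>)"
  shows "\<exists>v. is_maximum (sep_operator_values ds n \<eta> \<rho> j) v"
proof -
  let ?D = "prod_list ds" and ?\<rho>0 = "avg_state ds n \<eta> \<rho>"
  have \<rho>0: "psd ?D ?\<rho>0" by (rule avg_state_psd[OF ens])
  have \<rho>j: "\<rho> j \<in> carrier_mat ?D ?D" and \<eta>: "0 < \<eta> j"
    using ens j by (auto simp: ensemble_def state_carrier)
  let ?a = "\<lambda>\<sigma>s. Re (mtrace (\<rho> j * tensor \<sigma>s))" and ?b = "\<lambda>\<sigma>s. Re (mtrace (?\<rho>0 * tensor \<sigma>s))"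
  have b_pos: "0 < ?b \<sigma>s" if "list_all2 state ds \<sigma>s" for \<sigma>s
    by (rule psd_invertible_mtrace_pos[OF \<rho>0 inv state_tensor[OF that]])
  obtain \<sigma>s where \<sigma>s: "list_all2 state ds \<sigma>s"
    and max: "\<And>\<tau>s. list_all2 state ds \<tau>s \<Longrightarrow> ?a \<tau>s / ?b \<tau>s \<le> ?a \<sigma>s / ?b \<sigma>s"
    using product_state_ratio_attains_max[OF pos \<rho>j psd_carrier[OF \<rho>0] b_pos] by blast
  let ?v = "?a \<sigma>s / ?b \<sigma>s"
  \<comment> \<open>The maximum is attained at the best product state, scaled to trace 1 against the
    average state.\<close>
  let ?M = "complex_of_real (1 / ?b \<sigma>s) \<cdot>\<^sub>m tensor \<sigma>s"
  have T: "tensor \<sigma>s \<in> carrier_mat ?D ?D"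
    by (intro tensor_psd_carrier list_all2_state_psd \<sigma>s)
  have "?M \<in> SEP ds"
  proof -
    have "sum_mats ?D (map (\<lambda>(p, As). complex_of_real p \<cdot>\<^sub>m tensor As) [(1 / ?b \<sigma>s, \<sigma>s)]) \<in> SEP ds"
      using b_pos[OF \<sigma>s] \<sigma>s by (intro SEP_sum_tensorsI[OF pos]) (auto intro: list_all2_state_psd)
    then show ?thesis using T by simp
  qed
  \<comment> \<open>The normalisation constrains a complex trace, whereas \<open>?b\<close> is only
    its real part; positivity makes them agree.\<close>
  moreover have "mtrace (?\<rho>0 * tensor \<sigma>s) = complex_of_real (?b \<sigma>s)"
    using psd_mtrace_mult(1)[OF \<rho>0 psd_tensor[OF list_all2_state_psd[OF \<sigma>s]]]
    by (simp add: less_eq_complex_def complex_eq_iff)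
  then have "mtrace (?\<rho>0 * ?M) = 1"
    unfolding mtrace_mult_smult[OF psd_carrier[OF \<rho>0] T] using b_pos[OF \<sigma>s]
    by (metis less_numeral_extra(3) nonzero_eq_divide_eq of_real_1 of_real_mult)
  moreover have "\<eta> j * Re (mtrace (\<rho> j * ?M)) = \<eta> j * ?v"
    unfolding mtrace_mult_smult[OF \<rho>j T] by simp
  ultimately have mem: "\<eta> j * ?v \<in> sep_operator_values ds n \<eta> \<rho> j"
    unfolding sep_operator_values_def by force
  have "x \<le> \<eta> j * ?v" if x_mem: "x \<in> sep_operator_values ds n \<eta> \<rho> j" for x
  proof -
    obtain M where M: "M \<in> SEP ds" "mtrace (?\<rho>0 * M) = 1" and x: "x = \<eta> j * Re (mtrace (\<rho> j * M))"
      using x_mem unfolding sep_operator_values_def by blast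
    let ?g = "\<lambda>(p, \<sigma>s). complex_of_real p \<cdot>\<^sub>m tensor \<sigma>s"
    obtain ts where ts: "\<And>p \<sigma>s. (p, \<sigma>s) \<in> set ts \<Longrightarrow> 0 \<le> p \<and> list_all2 state ds \<sigma>s"
      "M = sum_mats ?D (map ?g ts)"
      using SEP_decompose[OF M(1)] by blast
    have carr: "set (map ?g ts) \<subseteq> carrier_mat ?D ?D"
      using ts(1) by (auto intro!: smult_carrier_mat tensor_psd_carrier list_all2_state_psd)
    have expand: "Re (mtrace (E * M)) = (\<Sum>(p, \<tau>s)\<leftarrow>ts. p * Re (mtrace (E * tensor \<tau>s)))"
      if E: "E \<in> carrier_mat ?D ?D" for E
    proof -
      have "mtrace (E * M) = (\<Sum>t\<leftarrow>ts. mtrace (E * ?g t))"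
        unfolding ts(2) mtrace_mult_sum_mats[OF E carr] by (simp add: comp_def)
      also have "\<dots> = (\<Sum>t\<leftarrow>ts. complex_of_real (fst t) * mtrace (E * tensor (snd t)))"
      proof (intro arg_cong[of _ _ sum_list] map_cong refl)
        fix t assume "t \<in> set ts"
        then have "tensor (snd t) \<in> carrier_mat ?D ?D"
          using ts(1)[of "fst t" "snd t"] by (intro tensor_psd_carrier list_all2_state_psd) simp
        then show "mtrace (E * ?g t) = complex_of_real (fst t) * mtrace (E * tensor (snd t))"
          using mtrace_mult_smult[OF E] by (simp add: case_prod_unfold)
      qed
      finally have "Re (mtrace (E * M)) = Re (\<Sum>t\<leftarrow>ts. complex_of_real (fst t) * mtrace (E * tensor (snd t)))"
        by simp
      also have "\<dots> = (\<Sum>(p, \<tau>s)\<leftarrow>ts. p * Re (mtrace (E * tensor \<tau>s)))"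
        by (induction ts) auto
      finally show ?thesis .
    qed
    \<comment> \<open>The mediant inequality with denominators cleared: each term satisfies
      \<open>?a \<tau>s \<le> ?v * ?b \<tau>s\<close>, and the weighted \<open>?b\<close> add up to
      the trace of \<open>M\<close> against the average state, which is 1.\<close>
    have "Re (mtrace (\<rho> j * M)) \<le> (\<Sum>(p, \<tau>s)\<leftarrow>ts. ?v * (p * ?b \<tau>s))"
      unfolding expand[OF \<rho>j]
    proof (rule sum_list_mono)
      fix t assume "t \<in> set ts"
      moreover obtain p \<tau>s where t: "t = (p, \<tau>s)" by (cases t)
      ultimately have p: "0 \<le> p" "list_all2 state ds \<tau>s" using ts(1) by auto
      have "?a \<tau>s \<le> ?v * ?b \<tau>s"
        using max[OF p(2)] b_pos[OF p(2)] by (simp add: pos_divide_le_eq)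
      then have "p * ?a \<tau>s \<le> p * (?v * ?b \<tau>s)" using p(1) by (rule mult_left_mono)
      then show "(case t of (p, \<tau>s) \<Rightarrow> p * ?a \<tau>s) \<le> (case t of (p, \<tau>s) \<Rightarrow> ?v * (p * ?b \<tau>s))"
        by (simp add: t mult_ac)
    qed
    also have "\<dots> = ?v * (\<Sum>(p, \<tau>s)\<leftarrow>ts. p * ?b \<tau>s)"
      by (simp only: sum_list_const_mult case_prod_unfold)
    also have "\<dots> = ?v" unfolding expand[OF psd_carrier[OF \<rho>0], symmetric] M(2) by simp
    finally show ?thesis unfolding x using \<eta> by (intro mult_left_mono) auto
  qed
  then show ?thesis using mem unfolding is_maximum_def by blast
qed

text \<open>Equal sets have the same supremum and the same maximum, if there is one, so the
  comparisons reduce to \<open>values_eq\<close>; only the final clause rests on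
  compactness.\<close>

theorem theorem1:
  fixes ds :: "nat list" and n :: nat and \<eta> :: "nat \<Rightarrow> real" and \<rho> :: "nat \<Rightarrow> complex mat" and j :: nat
  assumes "2 \<le> length ds"
    and "\<forall>d \<in> set ds. 0 < d"
    and "ensemble ds n \<eta> \<rho>"
    and "j \<in> {1..n}"
  shows "max_conf_locc ds n \<eta> \<rho> j = max_conf_sep ds n \<eta> \<rho> j
    \<and> max_conf_sep ds n \<eta> \<rho> j = Sup (sep_operator_values ds n \<eta> \<rho> j)
    \<and> (\<forall>v. is_maximum (locc_values ds n \<eta> \<rho> j) v \<longleftrightarrow> is_maximum (sep_values ds n \<eta> \<rho> j) v)
    \<and> (\<forall>v. is_maximum (sep_values ds n \<eta> \<rho> j) v \<longleftrightarrow> is_maximum (sep_operator_values ds n \<eta> \<rho> j) v)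
    \<and> (invertible_mat (avg_state ds n \<eta> \<rho>) \<longrightarrow>
         (\<exists>v. is_maximum (sep_operator_values ds n \<eta> \<rho> j) v))"
proof -
  have "ds \<noteq> []" using assms(1) by auto
  note eq = values_eq[OF this assms(2-4)]
  show ?thesis
    unfolding max_conf_locc_def max_conf_sep_def eq
    using sep_operator_values_attained[OF assms(2-4)] by blast
qed

end
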